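(* Let $u_t$ be the solution to $$\partial_t u_t(x)=\mathcal{L}u_t(x)+\sigma(u_t(x))\dot W(t,x),\qquad t>0,\ x\in\mathbb{R},$$ with initial condition $u_0$, and suppose that $\kappa:=\inf_{x\in\mathbb{R}}u_0(x)>0$. Then there exists $t_0>0$ such that for all $x\in\mathbb{R}$, $$\mathbb{E}|u_t(x)|^2=\infty\quad\text{whenever}\quad t\geq t_0.$$
   Context: Here $d=1$ and $1<\alpha<2$. The operator $\mathcal{L}=-(-\Delta)^{\alpha/2}$ is the fractional Laplacian, i.e. the generator of the symmetric (strictly) $\alpha$-stable process on $\mathbb{R}$, and $p_t(\cdot)$ denotes its heat kernel (transition density). $\dot W$ is space-time white noise. The function $\sigma:\mathbb{R}\to\mathbb{R}$ is locally Lipschitz and there is a $\gamma>0$ such that $\sigma(x)\geq|x|^{1+\gamma}$ for all $x\in\mathbb{R}$. The initial condition $u_0$ is a non-negative bounded deterministic function. The solution is understood in the mild sense of Walsh: $u$ is adapted to the filtration generated by the noise and satisfies $$u_t(x)=(\mathcal{G}u)_t(x)+\int_{\mathbb{R}}\int_0^t p_{t-s}(x-y)\sigma(u_s(y))\,W(\mathrm{d}s\,\mathrm{d}y),\qquad (\mathcal{G}u)_t(x):=\int_{\mathbb{R}}p_t(x-y)u_0(y)\,\mathrm{d}y.$$ Since $\sigma$ is only locally Lipschitz, existence and uniqueness is understood locally, i.e. on $(0,\min(t,\tau_N))$ with $\tau_N:=\inf\{t>0:\sup_{x}|u_t(x)|>N\}$. Moments such as $\mathbb{E}|u_t(x)|^2$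 take values in $[0,\infty]$. *)

theory Defs
  imports "HOL-Probability.Probability"
begin

text \<open>
  Space-time points are pairs \<open>(s, y)\<close> with time first. The noise is a random set function on
  the Borel subsets of \<open>[0,\<infinity>) \<times> \<real>\<close> of finite Lebesgue measure.
\<close>

definition noise_sets :: "(real \<times> real) set set" where
  "noise_sets = {A \<in> sets borel. A \<subseteq> {0..} \<times> UNIV \<and> emeasure lborel A < \<infinity>}"

text \<open>
  Walsh's definition of white noise based on Lebesgue measure: \<open>W A\<close> is \<open>N(0, |A|)\<close>, and over disjoint
  sets \<open>W\<close> is almost surely additive and independent. Null sets are listed separately because
  \<open>N(0, 0)\<close> has no density. Independence is required for whole disjoint families, so
  that \<open>W\<close> is a Gaussian family with covariance \<open>|A \<inter> B|\<close>.
\<close>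

locale white_noise = prob_space M for M :: "'a measure" +
  fixes W :: "(real \<times> real) set \<Rightarrow> 'a \<Rightarrow> real"
  assumes noise_measurable: "A \<in> noise_sets \<Longrightarrow> W A \<in> borel_measurable M"
    and noise_normal: "A \<in> noise_sets \<Longrightarrow> 0 < measure lborel A \<Longrightarrow>
      distributed M lborel (W A) (normal_density 0 (sqrt (measure lborel A)))"
    and noise_null: "A \<in> noise_sets \<Longrightarrow> measure lborel A = 0 \<Longrightarrow> AE \<omega> in M. W A \<omega> = 0"
    and noise_additive: "A \<in> noise_sets \<Longrightarrow> B \<in> noise_sets \<Longrightarrow> A \<inter> B = {} \<Longrightarrow>
      AE \<omega> in M. W (A \<union> B) \<omega> = W A \<omega> + W B \<omega>"
    and noise_indep: "\<A> \<subseteq> noise_sets \<Longrightarrow> disjoint \<A> \<Longrightarrow> indep_vars (\<lambda>_. borel) W \<A>"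

text \<open>The filtration generated by the noise, augmented by the null sets.\<close>

definition noise_filtration ::
    "'a measure \<Rightarrow> ((real \<times> real) set \<Rightarrow> 'a \<Rightarrow> real) \<Rightarrow> real \<Rightarrow> 'a measure" where
  "noise_filtration M W t = sigma (space M)
     ({W A -` B \<inter> space M | A B. A \<in> noise_sets \<and> A \<subseteq> {0..t} \<times> UNIV \<and> B \<in> sets borel}
      \<union> null_sets M)"

text \<open>
  A list of quadruples \<open>(X, a, b, A)\<close> encodes the simple integrand
  \<open>\<Sum> X(\<omega>) 1\<^bsub>(a,b]\<^esub>(s) 1\<^bsub>A\<^esub>(y)\<close>, each \<open>X\<close> being bounded and known at time \<open>a\<close>.
\<close>

type_synonym 'a simple_integrand = "(('a \<Rightarrow> real) \<times> real \<times> real \<times> real set) list"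

definition is_simple ::
    "'a measure \<Rightarrow> ((real \<times> real) set \<Rightarrow> 'a \<Rightarrow> real) \<Rightarrow> 'a simple_integrand \<Rightarrow> bool" where
  "is_simple M W l \<longleftrightarrow> (\<forall>(X, a, b, A) \<in> set l.
     0 \<le> a \<and> a \<le> b \<and> A \<in> sets borel \<and> emeasure lborel A < \<infinity> \<and>
     X \<in> borel_measurable (noise_filtration M W a) \<and> bounded (X ` space M))"

definition simple_value :: "'a simple_integrand \<Rightarrow> 'a \<Rightarrow> real \<times> real \<Rightarrow> real" where
  "simple_value l \<omega> z =
     (\<Sum>(X, a, b, A) \<leftarrow> l. X \<omega> * indicator {a<..b} (fst z) * indicator A (snd z))"

definition simple_integral ::
    "((real \<times> real) set \<Rightarrow> 'a \<Rightarrow> real) \<Rightarrow> 'a simple_integrand \<Rightarrow> 'a \<Rightarrow> real" where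
  "simple_integral W l \<omega> = (\<Sum>(X, a, b, A) \<leftarrow> l. X \<omega> * W ({a<..b} \<times> A) \<omega>)"

text \<open>
  \<open>has_walsh_integral M W \<Phi> I\<close>: the random field \<open>\<Phi>\<close> is Walsh integrable over \<open>(0,\<infinity>) \<times> \<real>\<close> and a
  version of its stochastic integral is \<open>I\<close>. As in Walsh's construction, this is the
  \<open>L\<^sup>2\<close>-closure of the integral of simple integrands; in particular it forces
  \<open>E \<integral>\<integral> \<Phi>\<^sup>2 ds dy < \<infinity>\<close>.
\<close>

definition has_walsh_integral ::
    "'a measure \<Rightarrow> ((real \<times> real) set \<Rightarrow> 'a \<Rightarrow> real) \<Rightarrow>
     ('a \<Rightarrow> real \<times> real \<Rightarrow> real) \<Rightarrow> ('a \<Rightarrow> real) \<Rightarrow> bool" where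
  "has_walsh_integral M W \<Phi> I \<longleftrightarrow>
     case_prod \<Phi> \<in> borel_measurable (M \<Otimes>\<^sub>M lborel) \<and> I \<in> borel_measurable M \<and>
     (\<exists>l :: nat \<Rightarrow> 'a simple_integrand. (\<forall>n. is_simple M W (l n)) \<and>
        (\<lambda>n. \<integral>\<^sup>+\<omega>. \<integral>\<^sup>+z. ennreal ((simple_value (l n) \<omega> z - \<Phi> \<omega> z)\<^sup>2) \<partial>lborel \<partial>M)
          \<longlonglongrightarrow> 0 \<and>
        (\<lambda>n. \<integral>\<^sup>+\<omega>. ennreal ((simple_integral W (l n) \<omega> - I \<omega>)\<^sup>2) \<partial>M) \<longlonglongrightarrow> 0)"

text \<open>
  \<open>p t\<close> is the continuous transition density of the symmetric \<open>\<alpha>\<close>-stable process generated by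
  \<open>- (-\<Delta>)\<^bsup>\<alpha>/2\<^esup>\<close>, that is, the density of a law with characteristic function
  \<open>\<xi> \<mapsto> exp (- t |\<xi>|\<^bsup>\<alpha>\<^esup>)\<close>. The value at \<open>\<xi> = 0\<close> makes it a probability density.
\<close>

definition stable_heat_kernel :: "real \<Rightarrow> (real \<Rightarrow> real \<Rightarrow> real) \<Rightarrow> bool" where
  "stable_heat_kernel \<alpha> p \<longleftrightarrow>
     (\<forall>t>0. continuous_on UNIV (p t) \<and> (\<forall>x. 0 \<le> p t x) \<and>
        (\<forall>\<xi>. char (density lborel (\<lambda>x. ennreal (p t x))) \<xi> =
              complex_of_real (exp (- t * \<bar>\<xi>\<bar> powr \<alpha>))))"

definition heat_flow :: "(real \<Rightarrow> real \<Rightarrow> real) \<Rightarrow> (real \<Rightarrow> real) \<Rightarrow> real \<Rightarrow> real \<Rightarrow> real" where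
  "heat_flow p u0 t x = (LINT y|lborel. p t (x - y) * u0 y)"

definition second_moment ::
    "'a measure \<Rightarrow> (real \<Rightarrow> real \<Rightarrow> 'a \<Rightarrow> real) \<Rightarrow> real \<Rightarrow> real \<Rightarrow> ennreal" where
  "second_moment M u t x = (\<integral>\<^sup>+\<omega>. ennreal (\<bar>u t x \<omega>\<bar>\<^sup>2) \<partial>M)"

text \<open>
  Mild solutions in the sense of Walsh. A Walsh integral is square integrable, so the mild equation
  at \<open>(t, x)\<close> can only hold if \<open>u t x\<close> has a finite second moment. Since solutions are
  only local and second moments are allowed to be infinite, the equation (including existence
  of its stochastic integral) is demanded exactly at the points with finite second moment.
  Demanding it at every \<open>(t, x)\<close> is a stronger condition, under which the second
  moments could never be infinite. Values of \<open>u\<close> at times \<open>t \<le> 0\<close> are irrelevant.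
\<close>

definition mild_solution ::
    "'a measure \<Rightarrow> ((real \<times> real) set \<Rightarrow> 'a \<Rightarrow> real) \<Rightarrow> (real \<Rightarrow> real \<Rightarrow> real) \<Rightarrow> (real \<Rightarrow> real) \<Rightarrow>
     (real \<Rightarrow> real) \<Rightarrow> (real \<Rightarrow> real \<Rightarrow> 'a \<Rightarrow> real) \<Rightarrow> bool" where
  "mild_solution M W p \<sigma> u0 u \<longleftrightarrow>
     (\<lambda>(\<omega>, t, x). u t x \<omega>)
       \<in> borel_measurable (M \<Otimes>\<^sub>M restrict_space lborel ({0<..} \<times> UNIV)) \<and>
     (\<forall>t>0. \<forall>x. u t x \<in> borel_measurable (noise_filtration M W t)) \<and>
     (\<forall>t>0. \<forall>x. second_moment M u t x < \<infinity> \<longrightarrow>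
        (\<exists>I. has_walsh_integral M W
               (\<lambda>\<omega> (s, y). indicator {0<..<t} s * (p (t - s) (x - y) * \<sigma> (u s y \<omega>))) I \<and>
             (AE \<omega> in M. u t x \<omega> = heat_flow p u0 t x + I \<omega>)))"

end

theory Submission
  imports Defs
begin

text \<open>
  Let \<open>F(t,x)\<close> be the second moment. If it is finite at \<open>(t,x)\<close>, the mild equation and the Walsh
  isometry bound it below, up to a constant, by \<open>\<kappa>\<^sup>2 + \<integral>\<integral> p\<^bsub>t-s\<^esub>(x-y)\<^sup>2 E \<sigma>(u\<^sub>s(y))\<^sup>2 dy ds\<close>. Jensen's
  inequality gives \<open>E \<sigma>(u\<^sub>s(y))\<^sup>2 \<ge> F(s,y)\<^bsup>1+\<gamma>\<^esup>\<close>, and \<open>\<integral> p\<^sub>r\<^sup>2\<close> is at least a multiple of \<open>r\<^bsup>-1/\<alpha>\<^esup>\<close>. So if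
  \<open>F \<ge> A\<close> after time \<open>T\<close>, then \<open>F \<ge> c A\<^bsup>1+\<gamma>\<^esup> (t-T)\<^bsup>1-1/\<alpha>\<^esup>\<close> for \<open>t > T\<close>, where \<open>1 - 1/\<alpha> > 0\<close>; the times
  needed to double the lower bound are summable, and \<open>F\<close> is infinite after their sum.
\<close>

section \<open>Independence of white noise over disjoint regions\<close>

text \<open>The solution is not known to have a finite second moment anywhere, so an integral
  equation for \<open>second_moment\<close> cannot be assumed. The argument therefore keeps to
  one-sided bounds in \<open>ennreal\<close>: where the moment is infinite every lower bound is
  free, and elsewhere the mild equation holds. What is handed from one time to the next is a
  constant lying below the moment at all later times and all points, because the noise term
  integrates over all of them; this uniformity is why a single \<open>t0\<close> serves every
  \<open>x\<close>. The laborious part is the isometry. Independence is given only for families of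
  disjoint sets and additivity only almost surely, whereas simple integrands need the whole past to
  be independent of the future. That independence is assembled from finite disjoint families, with
  the null sets adjoined throughout.\<close>

lemma noise_sets_subset:
  "A \<in> noise_sets \<Longrightarrow> B \<in> sets borel \<Longrightarrow> B \<subseteq> A \<Longrightarrow> B \<in> noise_sets"
  unfolding noise_sets_def
  by (auto intro: le_less_trans[OF emeasure_mono[of B A lborel]])

lemma noise_sets_Int: "A \<in> noise_sets \<Longrightarrow> B \<in> noise_sets \<Longrightarrow> A \<inter> B \<in> noise_sets"
  by (rule noise_sets_subset[of A]) (auto simp: noise_sets_def)

lemma noise_sets_Diff: "A \<in> noise_sets \<Longrightarrow> B \<in> noise_sets \<Longrightarrow> A - B \<in> noise_sets"
  by (rule noise_sets_subset[of A]) (auto simp: noise_sets_def)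

lemma noise_sets_Un:
  assumes "A \<in> noise_sets" "B \<in> noise_sets"
  shows "A \<union> B \<in> noise_sets"
proof -
  have "emeasure lborel (A \<union> B) \<le> emeasure lborel A + emeasure lborel B"
    using assms by (intro emeasure_subadditive) (auto simp: noise_sets_def)
  also have "\<dots> < \<infinity>" using assms by (simp add: noise_sets_def)
  finally show ?thesis using assms by (simp add: noise_sets_def sets.Un)
qed

lemma noise_sets_empty [simp]: "{} \<in> noise_sets"
  by (simp add: noise_sets_def)

lemma noise_sets_Union:
  "finite \<D> \<Longrightarrow> \<D> \<subseteq> noise_sets \<Longrightarrow> \<Union>\<D> \<in> noise_sets"
  by (induction rule: finite_induct) (auto intro: noise_sets_Un)

text \<open>The witnesses are the nonempty atoms of the algebra generated by \<open>\<A>\<close>.\<close>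

lemma noise_sets_disjoint_refinement:
  assumes "finite \<A>" "\<A> \<subseteq> noise_sets" "\<Union>\<A> \<subseteq> S"
  obtains \<D> where "finite \<D>" "\<D> \<subseteq> noise_sets" "disjoint \<D>" "{} \<notin> \<D>" "\<Union>\<D> \<subseteq> S"
    "\<And>A. A \<in> \<A> \<Longrightarrow> \<exists>\<E>\<subseteq>\<D>. A = \<Union>\<E>"
proof
  define atom where "atom P = \<Inter>P - \<Union>(\<A> - P)" for P
  \<comment> \<open>The empty \<open>P\<close> is left out because \<open>\<Inter>{}\<close> is the
    whole plane, whose part outside \<open>\<Union>\<A>\<close> has infinite measure. The empty atom
    is removed so that families over disjoint regions have no common member.\<close>
  define \<D> where "\<D> = atom ` (Pow \<A> - {{}}) - {{}}"
  show "finite \<D>" using assms(1) by (simp add: \<D>_def)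
  have atom: "atom P \<in> noise_sets \<and> atom P \<subseteq> S" if P: "P \<subseteq> \<A>" "P \<noteq> {}" for P
  proof -
    obtain A where A: "A \<in> P" using P by blast
    have "finite P" using P assms(1) finite_subset by blast
    then have "\<Inter>P \<in> sets borel"
    proof -
      have "(\<Inter>A\<in>P. A) \<in> sets borel"
        using P assms(2) \<open>finite P\<close> by (intro sets.finite_INT) (auto simp: noise_sets_def)
      then show ?thesis by simp
    qed
    moreover have "\<Union>(\<A> - P) \<in> sets borel"
      using assms(1,2) by (intro sets.finite_Union) (simp, force simp: noise_sets_def)
    ultimately have "atom P \<in> sets borel" unfolding atom_def by (rule sets.Diff)
    moreover have "atom P \<subseteq> A" using A by (auto simp: atom_def)
    ultimately show ?thesis using A that assms noise_sets_subset[of A "atom P"] by blast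
  qed
  show "\<D> \<subseteq> noise_sets" "\<Union>\<D> \<subseteq> S" using atom by (auto simp: \<D>_def)
  show "{} \<notin> \<D>" by (simp add: \<D>_def)
  have "atom P \<inter> atom Q = {}" if "P \<subseteq> \<A>" "Q \<subseteq> \<A>" "P \<noteq> Q" for P Q
    using that unfolding atom_def by blast
  then show "disjoint \<D>" unfolding disjoint_def \<D>_def by blast
  show "\<exists>\<E>\<subseteq>\<D>. A = \<Union>\<E>" if A: "A \<in> \<A>" for A
  proof (intro exI conjI)
    let ?E = "atom ` {P. P \<subseteq> \<A> \<and> A \<in> P} - {{}}"
    show "?E \<subseteq> \<D>" by (auto simp: \<D>_def)
    show "A = \<Union>?E"
    proof (intro equalityI subsetI)
      fix x assume "x \<in> A"
      then have "x \<in> atom {B \<in> \<A>. x \<in> B}" "A \<in> {B \<in> \<A>. x \<in> B}" using A by (auto simp: atom_def)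
      then show "x \<in> \<Union>?E" by (intro UnionI[of "atom {B \<in> \<A>. x \<in> B}"]) auto
    qed (auto simp: atom_def)
  qed
qed

text \<open>The filtration describes only the strips \<open>{0..t} \<times> UNIV\<close>.
  Independence of past and future also needs the noise over \<open>{c<..} \<times> UNIV\<close>,
  hence an arbitrary region \<open>S\<close>.\<close>

definition noise_algebra ::
    "'a measure \<Rightarrow> ((real \<times> real) set \<Rightarrow> 'a \<Rightarrow> real) \<Rightarrow> (real \<times> real) set \<Rightarrow> 'a measure" where
  "noise_algebra M W S = sigma (space M)
     ({W A -` B \<inter> space M | A B. A \<in> noise_sets \<and> A \<subseteq> S \<and> B \<in> sets borel} \<union> null_sets M)"

lemma noise_filtration_eq: "noise_filtration M W t = noise_algebra M W ({0..t} \<times> UNIV)"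
  by (simp add: noise_filtration_def noise_algebra_def)

text \<open>A set system rather than a measure, since these systems are united over many families to
  form a pi-system. Containing all null sets, each is unaffected by changing an event on a null
  set.\<close>

definition family_sets ::
    "'a measure \<Rightarrow> ((real \<times> real) set \<Rightarrow> 'a \<Rightarrow> real) \<Rightarrow> (real \<times> real) set set \<Rightarrow> 'a set set" where
  "family_sets M W \<D> = sigma_sets (space M)
     ({W D -` B \<inter> space M | D B. D \<in> \<D> \<and> B \<in> sets borel} \<union> null_sets M)"

context white_noise
begin

lemma space_noise_algebra [simp]: "space (noise_algebra M W S) = space M"
  by (simp add: noise_algebra_def space_measure_of_conv)

lemma sets_noise_algebra:
  "sets (noise_algebra M W S) = sigma_sets (space M)
     ({W A -` B \<inter> space M | A B. A \<in> noise_sets \<and> A \<subseteq> S \<and> B \<in> sets borel} \<union> null_sets M)"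
  unfolding noise_algebra_def
  by (rule sets_measure_of) (use sets.space_closed[of M] null_setsD2 in blast)

lemma noise_event: "A \<in> noise_sets \<Longrightarrow> B \<in> sets borel \<Longrightarrow> W A -` B \<inter> space M \<in> events"
  by (rule measurable_sets[OF noise_measurable])

lemma sets_noise_algebra_subset: "sets (noise_algebra M W S) \<subseteq> events"
  unfolding sets_noise_algebra
  by (rule sets.sigma_sets_subset) (use noise_event in blast)

lemma measurable_noise_algebra: "X \<in> measurable (noise_algebra M W S) N \<Longrightarrow> X \<in> measurable M N"
  by (rule measurable_from_subalg) (use sets_noise_algebra_subset in \<open>simp_all add: subalgebra_def\<close>)

lemma noise_algebra_mono:
  assumes "S \<subseteq> T" "X \<in> measurable (noise_algebra M W S) N"
  shows "X \<in> measurable (noise_algebra M W T) N"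
proof (rule measurable_from_subalg[OF _ assms(2)])
  from assms(1) have "sets (noise_algebra M W S) \<subseteq> sets (noise_algebra M W T)"
    unfolding sets_noise_algebra by (intro sigma_sets_mono') blast
  then show "subalgebra (noise_algebra M W T) (noise_algebra M W S)"
    by (simp add: subalgebra_def)
qed

lemma noise_measurable_algebra:
  assumes "A \<in> noise_sets" "A \<subseteq> S"
  shows "W A \<in> borel_measurable (noise_algebra M W S)"
  by (rule measurableI) (use assms in \<open>auto simp: sets_noise_algebra intro!: sigma_sets.Basic\<close>)

lemma noise_empty: "AE \<omega> in M. W {} \<omega> = 0"
  by (rule noise_null) auto

lemma noise_Union:
  assumes "finite \<D>" "\<D> \<subseteq> noise_sets" "disjoint \<D>"
  shows "AE \<omega> in M. W (\<Union>\<D>) \<omega> = (\<Sum>D\<in>\<D>. W D \<omega>)"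
  using assms
proof (induction rule: finite_induct)
  case empty
  then show ?case using noise_empty by simp
next
  case (insert D \<D>)
  have "D \<inter> \<Union>\<D> = {}" using insert.prems(2) insert.hyps(2) by (auto simp: disjoint_def)
  then have "AE \<omega> in M. W (D \<union> \<Union>\<D>) \<omega> = W D \<omega> + W (\<Union>\<D>) \<omega>"
    using insert by (intro noise_additive noise_sets_Union) auto
  moreover have "disjoint \<D>" using insert.prems(2) by (auto simp: disjoint_def)
  then have "AE \<omega> in M. W (\<Union>\<D>) \<omega> = (\<Sum>D\<in>\<D>. W D \<omega>)"
    using insert by auto
  ultimately show ?case
    by eventually_elim (simp add: insert.hyps)
qed

lemma sets_family: "\<D> \<subseteq> noise_sets \<Longrightarrow> family_sets M W \<D> \<subseteq> events"
  unfolding family_sets_def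
  by (rule sets.sigma_sets_subset) (use noise_event in blast)

text \<open>The null sets make the almost sure additivity of the noise an exact statement here.\<close>

lemma Union_in_family_sets:
  assumes \<D>: "finite \<D>" "\<D> \<subseteq> noise_sets" "disjoint \<D>" and "\<E> \<subseteq> \<D>" and B: "B \<in> sets borel"
  shows "W (\<Union>\<E>) -` B \<inter> space M \<in> family_sets M W \<D>"
proof -
  have \<E>: "finite \<E>" "\<E> \<subseteq> noise_sets" "disjoint \<E>"
    using finite_subset[OF assms(4,1)] assms(2-4) by (auto simp: disjoint_def)
  let ?F = "sigma (space M) ({W D -` B \<inter> space M | D B. D \<in> \<D> \<and> B \<in> sets borel} \<union> null_sets M)"
  have F: "sets ?F = family_sets M W \<D>" unfolding family_sets_def
    by (rule sets_measure_of) (use sets.space_closed[of M] null_setsD2 in blast)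
  have sp: "space ?F = space M" by (simp add: space_measure_of_conv)
  have "W D \<in> borel_measurable ?F" if "D \<in> \<D>" for D
  proof (rule measurableI)
    fix B :: "real set" assume "B \<in> sets borel"
    then have "W D -` B \<inter> space M \<in> family_sets M W \<D>"
      unfolding family_sets_def using that by (intro sigma_sets.Basic) blast
    then show "W D -` B \<inter> space ?F \<in> sets ?F" unfolding F sp .
  qed simp
  then have "(\<lambda>\<omega>. \<Sum>D\<in>\<E>. W D \<omega>) \<in> borel_measurable ?F"
    using assms(4) by (intro borel_measurable_sum) auto
  from measurable_sets[OF this B]
  have S: "(\<lambda>\<omega>. \<Sum>D\<in>\<E>. W D \<omega>) -` B \<inter> space M \<in> sets ?F" (is "?S \<in> _")
    unfolding sp .
  let ?T = "W (\<Union>\<E>) -` B \<inter> space M"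
  have T: "?T \<in> events"
    using noise_sets_Union[OF \<E>(1,2)] by (intro measurable_sets[OF noise_measurable] B)
  have SM: "?S \<in> events" using S F sets_family[OF \<D>(2)] by auto
  \<comment> \<open>The two preimages differ only where additivity fails. So \<open>?T\<close>
    arises from \<open>?S\<close> by removing one null set and adding another, both of which lie in
    \<open>?F\<close>.\<close>
  have "AE \<omega> in M. \<omega> \<notin> ?S - ?T"
    using noise_Union[OF \<E>] by eventually_elim auto
  then have 1: "?S - ?T \<in> null_sets M"
    using SM T by (auto simp: AE_iff_null_sets)
  have "AE \<omega> in M. \<omega> \<notin> ?T - ?S"
    using noise_Union[OF \<E>] by eventually_elim auto
  then have 2: "?T - ?S \<in> null_sets M"
    using SM T by (auto simp: AE_iff_null_sets)
  have "null_sets M \<subseteq> sets ?F" unfolding F family_sets_def by auto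
  then have "(?S - (?S - ?T)) \<union> (?T - ?S) \<in> sets ?F" using S 1 2 by blast
  also have "(?S - (?S - ?T)) \<union> (?T - ?S) = ?T" by blast
  finally show ?thesis using F by simp
qed

text \<open>\<open>noise_indep\<close> applies to the joint family, and grouping independent
  generators into two blocks preserves independence. Null events are independent of every event, so
  they can be adjoined to both blocks afterwards; the enlarged blocks are still closed under
  intersection and may be generated from.\<close>

lemma indep_family_sets:
  assumes noise: "\<A> \<subseteq> noise_sets" "\<B> \<subseteq> noise_sets" and "disjoint (\<A> \<union> \<B>)" "\<A> \<inter> \<B> = {}"
  shows "indep_set (family_sets M W \<A>) (family_sets M W \<B>)"
proof -
  define G where "G \<D> = sigma_sets (space M) (\<Union>D\<in>\<D>. {W D -` B \<inter> space M | B. B \<in> sets borel})"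
    for \<D>
  have "indep_sets (\<lambda>D. {W D -` B \<inter> space M | B. B \<in> sets borel}) (\<A> \<union> \<B>)"
    using noise_indep[of "\<A> \<union> \<B>"] assms unfolding indep_vars_def2 by auto
  \<comment> \<open>The blocks are indexed by \<open>bool\<close> because \<open>indep_set\<close>
    is defined through \<open>case_bool\<close>.\<close>
  then have "indep_sets (\<lambda>j. G (case_bool \<A> \<B> j)) (UNIV :: bool set)"
    unfolding G_def
  proof (intro indep_sets_collect_sigma)
    show "Int_stable {W D -` B \<inter> space M | B. B \<in> sets borel}" for D
    proof (intro Int_stableI; clarsimp)
      fix B C :: "real set" assume "B \<in> sets borel" "C \<in> sets borel"
      then show "\<exists>E. W D -` B \<inter> space M \<inter> (W D -` C \<inter> space M) = W D -` E \<inter> space M \<and> E \<in> sets borel"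
        by (intro exI[of _ "B \<inter> C"]) auto
    qed
  qed (use assms in \<open>auto simp: disjoint_family_on_def UNIV_bool Un_commute split: bool.splits\<close>)
  then have G: "indep_set (G \<A>) (G \<B>)"
    unfolding indep_set_def
    by (rule back_subst[of "\<lambda>f. indep_sets f UNIV"]) (auto split: bool.splits)
  have stable: "Int_stable (G \<D> \<union> null_sets M)" if "\<D> \<subseteq> noise_sets" for \<D>
  proof -
    have sub: "(\<Union>D\<in>\<D>. {W D -` B \<inter> space M | B. B \<in> sets borel}) \<subseteq> events"
      using that noise_event by blast
    then have "G \<D> \<subseteq> events" unfolding G_def by (rule sets.sigma_sets_subset)
    moreover have "sigma_algebra (space M) (G \<D>)" unfolding G_def
      using sub by (intro sigma_algebra_sigma_sets) (auto dest: sets.sets_into_space)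
    then have "a \<inter> b \<in> G \<D>" if "a \<in> G \<D>" "b \<in> G \<D>" for a b
      using that by (simp add: sigma_algebra_def algebra_iff_Int)
    ultimately show ?thesis
      using null_set_Int1 null_set_Int2 null_setsD2 by (intro Int_stableI) blast
  qed
  have "indep_set (G \<A> \<union> null_sets M) (G \<B> \<union> null_sets M)"
  proof (rule indep_setI)
    show "G \<A> \<union> null_sets M \<subseteq> events" "G \<B> \<union> null_sets M \<subseteq> events"
      using indep_setD_ev1[OF G] indep_setD_ev2[OF G] by auto
    fix a b assume "a \<in> G \<A> \<union> null_sets M" "b \<in> G \<B> \<union> null_sets M"
    then consider "a \<in> G \<A>" "b \<in> G \<B>" | "a \<in> null_sets M" "b \<in> events"
      | "b \<in> null_sets M" "a \<in> events"
      using indep_setD_ev1[OF G] indep_setD_ev2[OF G] by blast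
    then show "prob (a \<inter> b) = prob a * prob b"
    proof cases
      case 1
      then show ?thesis using indep_setD[OF G] by blast
    next
      case 2
      then have "a \<inter> b \<in> null_sets M" by (metis null_set_Int2)
      then show ?thesis using 2 by (simp add: null_sets_def measure_def)
    next
      case 3
      then have "a \<inter> b \<in> null_sets M" by (metis null_set_Int1)
      then show ?thesis using 3 by (simp add: null_sets_def measure_def)
    qed
  qed
  from indep_set_sigma_sets[OF this stable[OF noise(1)] stable[OF noise(2)]]
  show ?thesis
    unfolding indep_set_def
  proof (rule indep_sets_mono_sets)
    have "family_sets M W \<D> \<subseteq> sigma_sets (space M) (G \<D> \<union> null_sets M)" for \<D>
      unfolding family_sets_def G_def by (rule sigma_sets_mono') auto
    then show "\<And>i. case_bool (family_sets M W \<A>) (family_sets M W \<B>) i \<subseteq>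
        case_bool (sigma_sets (space M) (G \<A> \<union> null_sets M))
          (sigma_sets (space M) (G \<B> \<union> null_sets M)) i"
      by (auto split: bool.splits)
  qed
qed

text \<open>Each generator involves a single noise set or none. Any two finite families inside
  \<open>S\<close> have a common disjoint refinement inside \<open>S\<close>, so the union
  \<open>E S\<close> of the systems \<open>family_sets\<close> is closed under intersection.
  Independence of \<open>E S\<close> and \<open>E T\<close> reduces to two finite families, and the
  pi-system theorem extends it to the generated sigma-algebras.\<close>

lemma indep_noise_algebra:
  assumes "S \<inter> T = {}"
  shows "indep_set (sets (noise_algebra M W S)) (sets (noise_algebra M W T))"
proof -
  define \<F> where "\<F> S = {\<D>. finite \<D> \<and> \<D> \<subseteq> noise_sets \<and> disjoint \<D> \<and> {} \<notin> \<D> \<and> \<Union>\<D> \<subseteq> S}" for S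
  define E where "E S = (\<Union>\<D>\<in>\<F> S. family_sets M W \<D>)" for S
  have refine: "\<exists>\<D>\<in>\<F> S. \<forall>\<E>\<subseteq>\<A>. family_sets M W \<E> \<subseteq> family_sets M W \<D>"
    if \<A>: "finite \<A>" "\<A> \<subseteq> noise_sets" "\<Union>\<A> \<subseteq> S" for \<A> S
  proof -
    obtain \<D> where \<D>: "finite \<D>" "\<D> \<subseteq> noise_sets" "disjoint \<D>" "{} \<notin> \<D>" "\<Union>\<D> \<subseteq> S"
      and U: "\<And>A. A \<in> \<A> \<Longrightarrow> \<exists>\<E>\<subseteq>\<D>. A = \<Union>\<E>"
      using noise_sets_disjoint_refinement[OF \<A>] by metis
    have "family_sets M W \<E> \<subseteq> family_sets M W \<D>" if "\<E> \<subseteq> \<A>" for \<E>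
    proof -
      have *: "null_sets M \<subseteq> family_sets M W \<D>" unfolding family_sets_def by auto
      have **: "W A -` B \<inter> space M \<in> family_sets M W \<D>" if "A \<in> \<A>" "B \<in> sets borel" for A B
        using U[OF that(1)] Union_in_family_sets[OF \<D>(1-3) _ that(2)] by auto
      have "{W D -` B \<inter> space M | D B. D \<in> \<E> \<and> B \<in> sets borel} \<union> null_sets M
          \<subseteq> family_sets M W \<D>"
        using * ** \<open>\<E> \<subseteq> \<A>\<close> by blast
      then show ?thesis
        unfolding family_sets_def by (rule sigma_sets_mono)
    qed
    moreover have "\<D> \<in> \<F> S" using \<D> by (simp add: \<F>_def)
    ultimately show ?thesis by blast
  qed
  have stable: "Int_stable (E S)" for S
  proof (rule Int_stableI)
    fix a b assume "a \<in> E S" "b \<in> E S"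
    then obtain \<A> \<B> where *: "\<A> \<in> \<F> S" "\<B> \<in> \<F> S" "a \<in> family_sets M W \<A>" "b \<in> family_sets M W \<B>"
      by (auto simp: E_def)
    obtain \<D> where \<D>: "\<D> \<in> \<F> S" "\<And>\<E>. \<E> \<subseteq> \<A> \<union> \<B> \<Longrightarrow> family_sets M W \<E> \<subseteq> family_sets M W \<D>"
      using refine[of "\<A> \<union> \<B>" S] * by (auto simp: \<F>_def)
    have "a \<in> family_sets M W \<D>" "b \<in> family_sets M W \<D>"
      using * \<D>(2)[of \<A>] \<D>(2)[of \<B>] by auto
    moreover have "sigma_algebra (space M) (family_sets M W \<D>)"
      unfolding family_sets_def
      by (rule sigma_algebra_sigma_sets) (use sets.space_closed[of M] null_setsD2 in blast)
    ultimately have "a \<inter> b \<in> family_sets M W \<D>"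
      by (simp add: sigma_algebra_def algebra_iff_Int)
    then show "a \<inter> b \<in> E S" using \<D>(1) by (auto simp: E_def)
  qed
  have "indep_set (E S) (E T)"
  proof (rule indep_setI)
    show "E S \<subseteq> events" "E T \<subseteq> events" using sets_family by (auto simp: E_def \<F>_def)
    fix a b assume "a \<in> E S" "b \<in> E T"
    then obtain \<A> \<B> where *: "\<A> \<in> \<F> S" "\<B> \<in> \<F> T" "a \<in> family_sets M W \<A>" "b \<in> family_sets M W \<B>"
      by (auto simp: E_def)
    have cross: "A \<inter> B = {}" if "A \<in> \<A>" "B \<in> \<B>" for A B
    proof -
      have "A \<subseteq> S" "B \<subseteq> T" using that * by (auto simp: \<F>_def)
      then show ?thesis using assms by blast
    qed
    \<comment> \<open>A common member would be disjoint from itself, hence empty, and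
      \<open>\<F>\<close> excludes the empty set.\<close>
    have "A \<notin> \<B>" if "A \<in> \<A>" for A
      using cross[OF that, of A] that * by (auto simp: \<F>_def)
    then have "\<A> \<inter> \<B> = {}" by blast
    moreover have "\<Union>\<A> \<inter> \<Union>\<B> = {}" using cross by fast
    then have "disjoint (\<A> \<union> \<B>)"
      using * by (intro disjoint_union) (simp_all add: \<F>_def)
    ultimately have "indep_set (family_sets M W \<A>) (family_sets M W \<B>)"
      using * by (intro indep_family_sets) (auto simp: \<F>_def)
    then show "prob (a \<inter> b) = prob a * prob b" using * indep_setD by blast
  qed
  then have ind: "indep_set (sigma_sets (space M) (E S)) (sigma_sets (space M) (E T))"
    using stable by (intro indep_set_sigma_sets)
  have "sets (noise_algebra M W S) \<subseteq> sigma_sets (space M) (E S)" for S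
    unfolding sets_noise_algebra
  proof (rule sigma_sets_mono', rule subsetI)
    fix a assume "a \<in> {W A -` B \<inter> space M | A B. A \<in> noise_sets \<and> A \<subseteq> S \<and> B \<in> sets borel} \<union> null_sets M"
    then consider A B where "a = W A -` B \<inter> space M" "A \<in> noise_sets" "A \<subseteq> S" "B \<in> sets borel"
      | "a \<in> null_sets M" by blast
    then obtain \<A> where "finite \<A>" "\<A> \<subseteq> noise_sets" "\<Union>\<A> \<subseteq> S" "a \<in> family_sets M W \<A>"
    proof cases
      case 1
      then have *: "a \<in> family_sets M W {A}"
        unfolding family_sets_def by (intro sigma_sets.Basic) blast
      show thesis by (rule that[of "{A}"]) (use 1 * in simp_all)
    next
      case 2
      then have *: "a \<in> family_sets M W {}"
        unfolding family_sets_def by (intro sigma_sets.Basic) blast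
      show thesis by (rule that[of "{}"]) (use * in simp_all)
    qed
    moreover from this obtain \<D> where "\<D> \<in> \<F> S" "family_sets M W \<A> \<subseteq> family_sets M W \<D>"
      using refine[of \<A> S] by blast
    ultimately show "a \<in> E S" unfolding E_def by blast
  qed
  then show ?thesis
    using ind unfolding indep_set_def
    by (elim indep_sets_mono_sets) (simp split: bool.split)
qed

lemma indep_var_noise_algebra:
  fixes X Y :: "'a \<Rightarrow> real"
  assumes "S \<inter> T = {}" "X \<in> borel_measurable (noise_algebra M W S)"
    "Y \<in> borel_measurable (noise_algebra M W T)"
  shows "indep_var borel X borel Y"
proof -
  have sub: "sigma_sets (space M) {X -` A \<inter> space M | A. A \<in> sets borel} \<subseteq> sets (noise_algebra M W S)"
    if "X \<in> borel_measurable (noise_algebra M W S)" for S and X :: "'a \<Rightarrow> real"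
  proof -
    have "{X -` A \<inter> space M | A. A \<in> sets borel} \<subseteq> sets (noise_algebra M W S)"
      using measurable_sets[OF that] by (simp only: space_noise_algebra) blast
    from sets.sigma_sets_subset[OF this] show ?thesis by simp
  qed
  have "indep_set (sigma_sets (space M) {X -` A \<inter> space M | A. A \<in> sets borel})
     (sigma_sets (space M) {Y -` A \<inter> space M | A. A \<in> sets borel})"
    using indep_noise_algebra[OF assms(1)] sub[OF assms(2)] sub[OF assms(3)]
    unfolding indep_set_def
    by (elim indep_sets_mono_sets) (simp split: bool.split)
  then show ?thesis using assms(2,3)
    by (auto simp: indep_var_eq measurable_noise_algebra)
qed

end

section \<open>The Walsh isometry\<close>

text \<open>Used twice in the isometry: over the probability space for the stochastic integral and
  over space-time for the integrand. Both squares then become double sums that can be compared term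
  by term.\<close>

lemma has_bochner_integral_square_sum:
  fixes f :: "nat \<Rightarrow> 'a \<Rightarrow> real"
  assumes "\<And>i j. i < n \<Longrightarrow> j < n \<Longrightarrow> has_bochner_integral M (\<lambda>x. f i x * f j x) (c i j)"
  shows "has_bochner_integral M (\<lambda>x. (\<Sum>i<n. f i x)\<^sup>2) (\<Sum>i<n. \<Sum>j<n. c i j)"
proof -
  have "has_bochner_integral M (\<lambda>x. \<Sum>i<n. \<Sum>j<n. f i x * f j x) (\<Sum>i<n. \<Sum>j<n. c i j)"
    by (intro has_bochner_integral_sum assms) auto
  then show ?thesis by (simp add: power2_eq_square sum_product)
qed

lemma has_bochner_integral_ge_0:
  fixes f :: "'a \<Rightarrow> real"
  assumes "has_bochner_integral M f c" "\<And>x. 0 \<le> f x"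
  shows "0 \<le> c"
  using integral_nonneg_AE[of f M] assms by (auto simp: has_bochner_integral_iff)

lemma rectangle_noise_sets:
  assumes "0 \<le> a" "a \<le> b" "A \<in> sets borel" "emeasure lborel A < \<infinity>"
  shows "{a<..b} \<times> A \<in> noise_sets"
proof -
  have "{a<..b} \<times> A \<in> sets (borel \<Otimes>\<^sub>M borel)" using assms(3) by (intro pair_measureI) auto
  then have "{a<..b} \<times> A \<in> sets borel" unfolding borel_prod .
  moreover have "emeasure (lborel \<Otimes>\<^sub>M lborel) ({a<..b} \<times> A) = ennreal (b - a) * emeasure lborel A"
    using assms by (subst lborel.emeasure_pair_measure_Times) auto
  then have "emeasure lborel ({a<..b} \<times> A) < \<infinity>"
    using assms(4) by (simp add: lborel_prod ennreal_mult_less_top)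
  ultimately show ?thesis using assms(1) by (auto simp: noise_sets_def)
qed

lemma integrable_bounded_mult:
  fixes X Y :: "'a \<Rightarrow> real"
  assumes "X \<in> borel_measurable M" "bounded (X ` space M)" "integrable M Y"
  shows "integrable M (\<lambda>\<omega>. X \<omega> * Y \<omega>)"
proof -
  obtain C where C: "\<And>\<omega>. \<omega> \<in> space M \<Longrightarrow> \<bar>X \<omega>\<bar> \<le> C"
    using assms(2) unfolding bounded_iff by auto
  show ?thesis
  proof (rule Bochner_Integration.integrable_bound[of _ "\<lambda>\<omega>. C * Y \<omega>"])
    show "AE \<omega> in M. norm (X \<omega> * Y \<omega>) \<le> norm (C * Y \<omega>)"
    proof (rule AE_I2)
      fix \<omega> assume "\<omega> \<in> space M"
      from C[OF this] have "\<bar>X \<omega>\<bar> \<le> \<bar>C\<bar>" by linarith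
      then show "norm (X \<omega> * Y \<omega>) \<le> norm (C * Y \<omega>)" by (simp add: abs_mult mult_right_mono)
    qed
  qed (use assms in auto)
qed

text \<open>In the reals the right side minus the left is \<open>(2 * q - p)\<^sup>2\<close>. The
  form in \<open>ennreal\<close> can be integrated before anything is known to be finite.\<close>

lemma ennreal_square_le: "ennreal (p\<^sup>2) \<le> 2 * ennreal (q\<^sup>2) + 2 * ennreal ((q - p)\<^sup>2)"
proof -
  have "0 \<le> (2 * q - p)\<^sup>2" by simp
  then have "p\<^sup>2 \<le> 2 * q\<^sup>2 + 2 * (q - p)\<^sup>2" by (simp add: power2_eq_square algebra_simps)
  then have "ennreal (p\<^sup>2) \<le> ennreal (2 * q\<^sup>2 + 2 * (q - p)\<^sup>2)" by (rule ennreal_leI)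
  then show ?thesis by (simp add: ennreal_plus ennreal_mult)
qed

context white_noise
begin

section \<open>First and second moments of the noise\<close>

lemma has_bochner_integral_noise:
  assumes "A \<in> noise_sets"
  shows "has_bochner_integral M (W A) 0"
    and "has_bochner_integral M (\<lambda>\<omega>. W A \<omega> * W A \<omega>) (measure lborel A)"
proof -
  note [measurable] = noise_measurable[OF assms]
  have "has_bochner_integral M (W A) 0 \<and>
    has_bochner_integral M (\<lambda>\<omega>. W A \<omega> * W A \<omega>) (measure lborel A)"
  proof (cases "measure lborel A = 0")
    case True
    then have ae: "AE \<omega> in M. W A \<omega> = 0" by (rule noise_null[OF assms])
    have "has_bochner_integral M (W A) 0 = has_bochner_integral M (\<lambda>\<omega>. 0) (0::real)"
      by (intro has_bochner_integral_cong_AE) (use ae in auto)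
    moreover have "has_bochner_integral M (\<lambda>\<omega>. W A \<omega> * W A \<omega>) 0
        = has_bochner_integral M (\<lambda>\<omega>. 0) (0::real)"
      by (intro has_bochner_integral_cong_AE) (use ae in auto)
    ultimately show ?thesis using True by (simp add: has_bochner_integral_zero)
  next
    case False
    then have pos: "0 < measure lborel A" by (simp add: zero_less_measure_iff)
    then have sd: "0 < sqrt (measure lborel A)" by simp
    note D = noise_normal[OF assms pos]
    have 1: "integrable M (W A)"
      by (rule distributed_integrable_var[OF D])
        (use integrable_normal_moment_nz_1[OF sd, of 0] in auto)
    have 2: "integrable M (\<lambda>\<omega>. (W A \<omega>)\<^sup>2)"
      using distributed_integrable[OF D, of "\<lambda>x. x\<^sup>2"] integrable_normal_moment[OF sd, of 0 2]
      by simp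
    have e: "expectation (W A) = 0"
      by (rule normal_distributed_expectation[OF sd D])
    have "variance (W A) = measure lborel A"
      using normal_distributed_variance[OF sd D] by simp
    then have "expectation (\<lambda>\<omega>. (W A \<omega>)\<^sup>2) = measure lborel A" using e by simp
    then show ?thesis using 1 2 e by (simp add: has_bochner_integral_iff power2_eq_square)
  qed
  then show "has_bochner_integral M (W A) 0"
    and "has_bochner_integral M (\<lambda>\<omega>. W A \<omega> * W A \<omega>) (measure lborel A)" by auto
qed

lemma has_bochner_integral_indep_mult:
  fixes X Y :: "'a \<Rightarrow> real"
  assumes "S \<inter> T = {}" "X \<in> borel_measurable (noise_algebra M W S)"
    "Y \<in> borel_measurable (noise_algebra M W T)"
    "has_bochner_integral M X x" "has_bochner_integral M Y y"
  shows "has_bochner_integral M (\<lambda>\<omega>. X \<omega> * Y \<omega>) (x * y)"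
  using indep_var_noise_algebra[OF assms(1-3)] assms(4,5)
    indep_var_lebesgue_integral[of X Y] indep_var_integrable[of X Y]
  by (simp add: has_bochner_integral_iff)

lemma noise_split:
  assumes "A \<in> noise_sets" "B \<in> noise_sets"
  shows "AE \<omega> in M. W A \<omega> = W (A \<inter> B) \<omega> + W (A - B) \<omega>"
proof -
  have "A = (A \<inter> B) \<union> (A - B)" by blast
  then show ?thesis
    using noise_additive[of "A \<inter> B" "A - B"] noise_sets_Int[OF assms] noise_sets_Diff[OF assms]
    by (metis Diff_disjoint Int_Diff inf.left_idem inf_commute)
qed

text \<open>Split each set into \<open>A \<inter> B\<close> and the remainder. Of the four products
  only the square over \<open>A \<inter> B\<close> survives; the others pair independent centred
  variables.\<close>

lemma noise_covariance:
  assumes A: "A \<in> noise_sets" and B: "B \<in> noise_sets"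
  shows "has_bochner_integral M (\<lambda>\<omega>. W A \<omega> * W B \<omega>) (measure lborel (A \<inter> B))"
proof -
  note [measurable] = noise_measurable
  have C: "A \<inter> B \<in> noise_sets" and D: "A - B \<in> noise_sets" and E: "B - A \<in> noise_sets"
    using A B by (auto intro: noise_sets_Int noise_sets_Diff)
  \<comment> \<open>The value is left as \<open>0 * 0\<close> to match the product form of
    \<open>has_bochner_integral_indep_mult\<close>.\<close>
  have disj: "has_bochner_integral M (\<lambda>\<omega>. W P \<omega> * W Q \<omega>) (0 * 0)"
    if "P \<in> noise_sets" "Q \<in> noise_sets" "P \<inter> Q = {}" for P Q
    using that by (intro has_bochner_integral_indep_mult[of P Q] noise_measurable_algebra
      has_bochner_integral_noise) auto
  have "has_bochner_integral M (\<lambda>\<omega>. W (A \<inter> B) \<omega> * W (A \<inter> B) \<omega> + W (A \<inter> B) \<omega> * W (B - A) \<omega>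
      + (W (A - B) \<omega> * W (A \<inter> B) \<omega> + W (A - B) \<omega> * W (B - A) \<omega>))
    (measure lborel (A \<inter> B) + 0 * 0 + (0 * 0 + 0 * 0))"
    using C D E by (intro has_bochner_integral_add disj has_bochner_integral_noise(2)) auto
  moreover have "AE \<omega> in M. W A \<omega> * W B \<omega> =
      W (A \<inter> B) \<omega> * W (A \<inter> B) \<omega> + W (A \<inter> B) \<omega> * W (B - A) \<omega>
      + (W (A - B) \<omega> * W (A \<inter> B) \<omega> + W (A - B) \<omega> * W (B - A) \<omega>)"
    using noise_split[OF A B] noise_split[OF B A]
    by eventually_elim (simp add: Int_commute algebra_simps)
  ultimately show ?thesis
    using A B C D E
    by (subst has_bochner_integral_cong_AE) (auto intro!: noise_measurable)
qed

section \<open>Moments of simple stochastic integrals\<close>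

lemma simple_term_mean:
  assumes "0 \<le> a" "a \<le> b" "A \<in> sets borel" "emeasure lborel A < \<infinity>"
    and X: "X \<in> borel_measurable (noise_filtration M W a)" "bounded (X ` space M)"
  shows "has_bochner_integral M (\<lambda>\<omega>. X \<omega> * W ({a<..b} \<times> A) \<omega>) 0"
proof -
  have X': "X \<in> borel_measurable (noise_algebra M W ({0..a} \<times> UNIV))"
    using X(1) by (simp add: noise_filtration_eq)
  have R: "{a<..b} \<times> A \<in> noise_sets" by (rule rectangle_noise_sets) fact+
  have "has_bochner_integral M X (expectation X)"
    using integrable_bounded_mult[OF measurable_noise_algebra[OF X'] X(2), of "\<lambda>_. 1"]
    by (simp add: has_bochner_integral_iff)
  \<comment> \<open>The interval \<open>{a<..b}\<close> is open on the left, so the rectangle misses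
    the strip \<open>{0..a} \<times> UNIV\<close>. Its centred noise is therefore independent of
    \<open>X\<close>.\<close>
  then have "has_bochner_integral M (\<lambda>\<omega>. X \<omega> * W ({a<..b} \<times> A) \<omega>) (expectation X * 0)"
    using R by (intro has_bochner_integral_indep_mult[OF _ X' noise_measurable_algebra[OF R order_refl]]
      has_bochner_integral_noise) auto
  then show ?thesis by simp
qed

text \<open>The rectangles may overlap. Ordering the two terms by starting time makes both
  coefficients known at the later start, and after that time only a covariance of pure noise
  remains.\<close>

lemma simple_term_covariance:
  assumes 1: "0 \<le> a" "a \<le> b" "A \<in> sets borel" "emeasure lborel A < \<infinity>"
      "X \<in> borel_measurable (noise_filtration M W a)" "bounded (X ` space M)"
    and 2: "0 \<le> a'" "a' \<le> b'" "A' \<in> sets borel" "emeasure lborel A' < \<infinity>"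
      "X' \<in> borel_measurable (noise_filtration M W a')" "bounded (X' ` space M)"
  shows "has_bochner_integral M
    (\<lambda>\<omega>. (X \<omega> * W ({a<..b} \<times> A) \<omega>) * (X' \<omega> * W ({a'<..b'} \<times> A') \<omega>))
    (expectation (\<lambda>\<omega>. X \<omega> * X' \<omega>) * measure lborel (({a<..b} \<times> A) \<inter> ({a'<..b'} \<times> A')))"
proof -
  text \<open>The part of the earlier rectangle before \<open>c\<close> belongs to the past of the later one.\<close>
  have *: "has_bochner_integral M
      (\<lambda>\<omega>. (X \<omega> * W R \<omega>) * (X' \<omega> * W R' \<omega>))
      (expectation (\<lambda>\<omega>. X \<omega> * X' \<omega>) * measure lborel (R \<inter> R'))"
    if "0 \<le> a" "a \<le> c"
      and X: "X \<in> borel_measurable (noise_filtration M W a)" "bounded (X ` space M)"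
      and X': "X' \<in> borel_measurable (noise_filtration M W c)" "bounded (X' ` space M)"
      and R: "R \<in> noise_sets" "R' \<in> noise_sets" "R' \<subseteq> {c<..} \<times> UNIV"
    for a c and X X' :: "'a \<Rightarrow> real" and R R'
  proof -
    let ?S = "{0..c} \<times> (UNIV :: real set)" and ?T = "{c<..} \<times> (UNIV :: real set)"
    have X1: "X \<in> borel_measurable (noise_algebra M W ?S)"
      using \<open>a \<le> c\<close> by (intro noise_algebra_mono[OF _ X(1)[unfolded noise_filtration_eq]]) auto
    have X2: "X' \<in> borel_measurable (noise_algebra M W ?S)"
      using X'(1) unfolding noise_filtration_eq .
    have XM: "X \<in> borel_measurable M" "X' \<in> borel_measurable M"
      using X1 X2 measurable_noise_algebra by blast+
    define P where "P = R \<inter> ?S"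
    define Q where "Q = R \<inter> ?T"
    \<comment> \<open>Nothing of \<open>R\<close> is lost, since members of
      \<open>noise_sets\<close> contain no negative times.\<close>
    have Un: "R = P \<union> Q"
      using R(1) unfolding P_def Q_def noise_sets_def by auto
    have "closed ?S" by (intro closed_Times) auto
    moreover have "open ?T" by (intro open_Times) auto
    ultimately have bor: "?S \<in> sets borel" "?T \<in> sets borel" by auto
    have PQ: "P \<in> noise_sets" "Q \<in> noise_sets"
      using R(1) bor noise_sets_subset[OF R(1)] unfolding P_def Q_def
      by (simp_all add: noise_sets_def sets.Int)
    have sub: "P \<subseteq> ?S" "Q \<subseteq> ?T" "P \<inter> Q = {}" "?S \<inter> ?T = {}" by (auto simp: P_def Q_def)
    note m = noise_measurable_algebra[OF PQ(1) sub(1)] noise_measurable_algebra[OF PQ(2) sub(2)]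
      noise_measurable_algebra[OF R(2,3)]
    have "has_bochner_integral M (\<lambda>\<omega>. X \<omega> * (X' \<omega> * W P \<omega>))
        (expectation (\<lambda>\<omega>. X \<omega> * (X' \<omega> * W P \<omega>)))"
      using has_bochner_integral_noise(1)[OF PQ(1)] X X' XM
      by (intro has_bochner_integral_integrable integrable_bounded_mult)
        (auto simp: has_bochner_integral_iff)
    \<comment> \<open>The coefficients and \<open>W P\<close> are all known at time
      \<open>c\<close>, while \<open>W R'\<close> is independent of that past and has mean 0, so
      this product contributes nothing.\<close>
    then have "has_bochner_integral M (\<lambda>\<omega>. X \<omega> * (X' \<omega> * W P \<omega>) * W R' \<omega>)
        (expectation (\<lambda>\<omega>. X \<omega> * (X' \<omega> * W P \<omega>)) * 0)"
      using X1 X2 m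
      by (intro has_bochner_integral_indep_mult[OF sub(4)] has_bochner_integral_noise R
          borel_measurable_times)
    moreover have "has_bochner_integral M (\<lambda>\<omega>. X \<omega> * X' \<omega>) (expectation (\<lambda>\<omega>. X \<omega> * X' \<omega>))"
      using integrable_bounded_mult[OF XM(2) X'(2), of "\<lambda>_. 1"]
      by (intro has_bochner_integral_integrable integrable_bounded_mult XM X) simp
    then have "has_bochner_integral M (\<lambda>\<omega>. X \<omega> * X' \<omega> * (W Q \<omega> * W R' \<omega>))
        (expectation (\<lambda>\<omega>. X \<omega> * X' \<omega>) * measure lborel (Q \<inter> R'))"
      using X1 X2 m
      by (intro has_bochner_integral_indep_mult[OF sub(4)] noise_covariance R PQ
          borel_measurable_times)
    ultimately have "has_bochner_integral M
      (\<lambda>\<omega>. X \<omega> * (X' \<omega> * W P \<omega>) * W R' \<omega> + X \<omega> * X' \<omega> * (W Q \<omega> * W R' \<omega>))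
      (expectation (\<lambda>\<omega>. X \<omega> * (X' \<omega> * W P \<omega>)) * 0
        + expectation (\<lambda>\<omega>. X \<omega> * X' \<omega>) * measure lborel (Q \<inter> R'))"
      by (rule has_bochner_integral_add)
    moreover have "Q \<inter> R' = R \<inter> R'" using R(3) by (auto simp: Q_def)
    moreover have "AE \<omega> in M. (X \<omega> * W R \<omega>) * (X' \<omega> * W R' \<omega>) =
        X \<omega> * (X' \<omega> * W P \<omega>) * W R' \<omega> + X \<omega> * X' \<omega> * (W Q \<omega> * W R' \<omega>)"
      using noise_additive[OF PQ sub(3)] unfolding Un[symmetric]
      by eventually_elim (simp add: algebra_simps)
    ultimately show ?thesis
      using XM noise_measurable[OF PQ(1)] noise_measurable[OF PQ(2)] noise_measurable[OF R(1)]
        noise_measurable[OF R(2)]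
      by (subst has_bochner_integral_cong_AE) (auto intro!: borel_measurable_times borel_measurable_add)
  qed
  have R: "{a<..b} \<times> A \<in> noise_sets" "{a'<..b'} \<times> A' \<in> noise_sets"
    by (rule rectangle_noise_sets; fact)+
  show ?thesis
  proof (cases "a \<le> a'")
    case True
    show ?thesis by (rule *[OF 1(1) True 1(5,6) 2(5,6) R]) auto
  next
    case False
    then have "a' \<le> a" by simp
    have "{a<..b} \<times> A \<subseteq> {a<..} \<times> UNIV" by auto
    from *[OF 2(1) \<open>a' \<le> a\<close> 2(5,6) 1(5,6) R(2,1) this] show ?thesis by (simp add: mult.commute Int_commute)
  qed
qed

text \<open>Since the rectangles of the list may overlap, the squares expand into full double sums
  rather than diagonal ones. The stochastic integral and the integrand give the same entries
  \<open>c i j\<close>. The constant \<open>G\<close> adds only its square because the integral has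
  mean 0.\<close>

lemma
  assumes "is_simple M W l"
  shows simple_integral_second_moment:
      "0 \<le> G \<Longrightarrow> (\<integral>\<^sup>+\<omega>. ennreal ((G + simple_integral W l \<omega>)\<^sup>2) \<partial>M) =
        ennreal (G\<^sup>2) + (\<integral>\<^sup>+\<omega>. \<integral>\<^sup>+z. ennreal ((simple_value l \<omega> z)\<^sup>2) \<partial>lborel \<partial>M)"
    and simple_integral_measurable: "simple_integral W l \<in> borel_measurable M"
    and simple_value_measurable: "case_prod (simple_value l) \<in> borel_measurable (M \<Otimes>\<^sub>M lborel)"
proof -
  define n where "n = length l"
  define X where "X i = fst (l ! i)" for i
  define a where "a i = fst (snd (l ! i))" for i
  define b where "b i = fst (snd (snd (l ! i)))" for i
  define A where "A i = snd (snd (snd (l ! i)))" for i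
  define R where "R i = {a i<..b i} \<times> A i" for i
  have l: "0 \<le> a i \<and> a i \<le> b i \<and> A i \<in> sets borel \<and> emeasure lborel (A i) < \<infinity> \<and>
     X i \<in> borel_measurable (noise_filtration M W (a i)) \<and> bounded (X i ` space M)"
    if "i < n" for i
    using assms nth_mem[of i l] that unfolding is_simple_def n_def X_def a_def b_def A_def
    by (auto simp: split_beta)
  have S: "simple_integral W l = (\<lambda>\<omega>. \<Sum>i<n. X i \<omega> * W (R i) \<omega>)"
    by (rule ext) (simp add: simple_integral_def sum_list_sum_nth n_def X_def a_def b_def A_def R_def
        split_beta atLeast0LessThan)
  have V: "simple_value l \<omega> z = (\<Sum>i<n. X i \<omega> * indicator (R i) z)" for \<omega> z
    by (simp add: simple_value_def sum_list_sum_nth n_def X_def a_def b_def A_def R_def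
        split_beta atLeast0LessThan indicator_times mult.assoc)
  have XM: "X i \<in> borel_measurable M" if "i < n" for i
    using l[OF that] unfolding noise_filtration_eq by (blast intro: measurable_noise_algebra)
  have R: "R i \<in> noise_sets" if "i < n" for i
    using l[OF that] unfolding R_def by (blast intro: rectangle_noise_sets)
  define c where "c i j = expectation (\<lambda>\<omega>. X i \<omega> * X j \<omega>) * measure lborel (R i \<inter> R j)" for i j
  define C where "C = (\<Sum>i<n. \<Sum>j<n. c i j)"
  show "simple_integral W l \<in> borel_measurable M"
    unfolding S using XM noise_measurable[OF R] by (intro borel_measurable_sum borel_measurable_times) auto
  have "(\<lambda>(\<omega>, z). X i \<omega> * indicator (R i) z) \<in> borel_measurable (M \<Otimes>\<^sub>M lborel)" if "i < n" for i
  proof -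
    note [measurable] = XM[OF that]
    have [measurable]: "R i \<in> sets lborel" using R[OF that] by (simp add: noise_sets_def)
    show ?thesis by measurable
  qed
  then show "case_prod (simple_value l) \<in> borel_measurable (M \<Otimes>\<^sub>M lborel)"
    unfolding V split_beta by (intro borel_measurable_sum) auto
  have "has_bochner_integral M (\<lambda>\<omega>. (\<Sum>i<n. X i \<omega> * W (R i) \<omega>)\<^sup>2) C"
    unfolding C_def c_def R_def
    by (intro has_bochner_integral_square_sum simple_term_covariance) (use l in blast)+
  then have S2: "has_bochner_integral M (\<lambda>\<omega>. (simple_integral W l \<omega>)\<^sup>2) C" unfolding S .
  have "has_bochner_integral M (\<lambda>\<omega>. \<Sum>i<n. X i \<omega> * W (R i) \<omega>) (\<Sum>i<n. 0)"
    unfolding R_def by (intro has_bochner_integral_sum simple_term_mean) (use l in auto)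
  then have S1: "has_bochner_integral M (simple_integral W l) 0" unfolding S by simp
  have XX: "integrable M (\<lambda>\<omega>. X i \<omega> * X j \<omega>)" if "i < n" "j < n" for i j
    using integrable_bounded_mult[OF XM[OF that(2)], of "\<lambda>_. 1"] l that
    by (intro integrable_bounded_mult XM) auto
  have fin: "emeasure lborel (R i \<inter> R j) < \<infinity>" if "i < n" "j < n" for i j
    using noise_sets_Int[OF R[OF that(1)] R[OF that(2)]] by (simp add: noise_sets_def)
  have Rb: "R i \<in> sets borel" if "i < n" for i
    using R[OF that] by (simp add: noise_sets_def)
  have V2: "(\<integral>\<^sup>+z. ennreal ((simple_value l \<omega> z)\<^sup>2) \<partial>lborel) =
      ennreal (\<Sum>i<n. \<Sum>j<n. X i \<omega> * X j \<omega> * measure lborel (R i \<inter> R j))"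
    and V2_nonneg: "0 \<le> (\<Sum>i<n. \<Sum>j<n. X i \<omega> * X j \<omega> * measure lborel (R i \<inter> R j))" for \<omega>
  proof -
    have "has_bochner_integral lborel
        (\<lambda>z. (X i \<omega> * indicator (R i) z) * (X j \<omega> * indicator (R j) z))
        (X i \<omega> * X j \<omega> * measure lborel (R i \<inter> R j))" if "i < n" "j < n" for i j
    proof -
      have "has_bochner_integral lborel (indicator (R i \<inter> R j) :: _ \<Rightarrow> real)
          (measure lborel (R i \<inter> R j))"
        using fin[OF that] Rb that by (intro has_bochner_integral_real_indicator) (auto intro: sets.Int)
      then have "has_bochner_integral lborel (\<lambda>z. X i \<omega> * X j \<omega> * indicator (R i \<inter> R j) z)
          (X i \<omega> * X j \<omega> * measure lborel (R i \<inter> R j))"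
        by (rule has_bochner_integral_mult_right)
      then show ?thesis by (simp add: indicator_inter_arith ac_simps)
    qed
    then have h: "has_bochner_integral lborel (\<lambda>z. (simple_value l \<omega> z)\<^sup>2)
        (\<Sum>i<n. \<Sum>j<n. X i \<omega> * X j \<omega> * measure lborel (R i \<inter> R j))"
      unfolding V by (rule has_bochner_integral_square_sum)
    then show "(\<integral>\<^sup>+z. ennreal ((simple_value l \<omega> z)\<^sup>2) \<partial>lborel) =
      ennreal (\<Sum>i<n. \<Sum>j<n. X i \<omega> * X j \<omega> * measure lborel (R i \<inter> R j))"
      by (subst nn_integral_eq_integral) (auto simp: has_bochner_integral_iff)
    show "0 \<le> (\<Sum>i<n. \<Sum>j<n. X i \<omega> * X j \<omega> * measure lborel (R i \<inter> R j))"
      using has_bochner_integral_ge_0[OF h] by simp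
  qed
  have hV: "has_bochner_integral M
      (\<lambda>\<omega>. \<Sum>i<n. \<Sum>j<n. X i \<omega> * X j \<omega> * measure lborel (R i \<inter> R j)) C"
    unfolding C_def c_def using XX
    by (intro has_bochner_integral_sum has_bochner_integral_mult_left) (simp add: has_bochner_integral_iff)
  \<comment> \<open>For each outcome the space-time integral is an explicit finite sum in the
    coefficients. Its expectation can be taken termwise and equals the \<open>C\<close> of the
    stochastic side, which is the isometry.\<close>
  have VC: "(\<integral>\<^sup>+\<omega>. \<integral>\<^sup>+z. ennreal ((simple_value l \<omega> z)\<^sup>2) \<partial>lborel \<partial>M) = ennreal C"
    unfolding V2 using hV V2_nonneg
    by (subst nn_integral_eq_integral) (auto simp: has_bochner_integral_iff)
  have C0: "0 \<le> C"
    by (rule has_bochner_integral_ge_0[OF hV V2_nonneg])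
  show "(\<integral>\<^sup>+\<omega>. ennreal ((G + simple_integral W l \<omega>)\<^sup>2) \<partial>M) =
      ennreal (G\<^sup>2) + (\<integral>\<^sup>+\<omega>. \<integral>\<^sup>+z. ennreal ((simple_value l \<omega> z)\<^sup>2) \<partial>lborel \<partial>M)"
  proof -
    have "has_bochner_integral M (\<lambda>\<omega>. G\<^sup>2) (G\<^sup>2)"
      by (simp add: has_bochner_integral_iff prob_space)
    from has_bochner_integral_add[OF has_bochner_integral_add[OF this
        has_bochner_integral_mult_right[OF S1, of "2 * G"]] S2]
    have h: "has_bochner_integral M (\<lambda>\<omega>. (G + simple_integral W l \<omega>)\<^sup>2) (G\<^sup>2 + C)"
      by (simp add: power2_sum ac_simps)
    then have "(\<integral>\<^sup>+\<omega>. ennreal ((G + simple_integral W l \<omega>)\<^sup>2) \<partial>M) = ennreal (G\<^sup>2 + C)"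
      by (subst nn_integral_eq_integral) (auto simp: has_bochner_integral_iff)
    then show ?thesis using C0 VC by simp
  qed
qed

text \<open>The triangle inequality in \<open>L\<^sup>2\<close> is replaced by \<open>(p + q)\<^sup>2 \<le> 2 p\<^sup>2 + 2 q\<^sup>2\<close>, hence the factor 4
  instead of an equality; the lost constant is harmless for the blow-up argument.\<close>

lemma walsh_integral_lower_bound:
  assumes "has_walsh_integral M W \<Phi> I" "0 \<le> G"
  shows "ennreal (G\<^sup>2) + (\<integral>\<^sup>+\<omega>. \<integral>\<^sup>+z. ennreal ((\<Phi> \<omega> z)\<^sup>2) \<partial>lborel \<partial>M)
    \<le> 4 * (\<integral>\<^sup>+\<omega>. ennreal ((G + I \<omega>)\<^sup>2) \<partial>M)"
proof -
  obtain l where \<Phi>[measurable]: "case_prod \<Phi> \<in> borel_measurable (M \<Otimes>\<^sub>M lborel)"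
    and I[measurable]: "I \<in> borel_measurable M" and l: "\<And>n. is_simple M W (l n)"
    and d: "(\<lambda>n. \<integral>\<^sup>+\<omega>. \<integral>\<^sup>+z. ennreal ((simple_value (l n) \<omega> z - \<Phi> \<omega> z)\<^sup>2) \<partial>lborel \<partial>M) \<longlonglongrightarrow> 0"
    and e: "(\<lambda>n. \<integral>\<^sup>+\<omega>. ennreal ((simple_integral W (l n) \<omega> - I \<omega>)\<^sup>2) \<partial>M) \<longlonglongrightarrow> 0"
    using assms(1) unfolding has_walsh_integral_def by blast
  note [measurable] = simple_integral_measurable[OF l] simple_value_measurable[OF l]
  define D where "D n = (\<integral>\<^sup>+\<omega>. \<integral>\<^sup>+z. ennreal ((simple_value (l n) \<omega> z - \<Phi> \<omega> z)\<^sup>2) \<partial>lborel \<partial>M)" for n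
  define E where "E n = (\<integral>\<^sup>+\<omega>. ennreal ((simple_integral W (l n) \<omega> - I \<omega>)\<^sup>2) \<partial>M)" for n
  let ?K = "\<integral>\<^sup>+\<omega>. ennreal ((G + I \<omega>)\<^sup>2) \<partial>M"
  let ?F = "\<integral>\<^sup>+\<omega>. \<integral>\<^sup>+z. ennreal ((\<Phi> \<omega> z)\<^sup>2) \<partial>lborel \<partial>M"
  have le: "ennreal (G\<^sup>2) + ?F \<le> 4 * ?K + 4 * E n + 2 * D n" for n
  proof -
    let ?V = "\<integral>\<^sup>+\<omega>. \<integral>\<^sup>+z. ennreal ((simple_value (l n) \<omega> z)\<^sup>2) \<partial>lborel \<partial>M"
    have "?F \<le> (\<integral>\<^sup>+\<omega>. \<integral>\<^sup>+z. 2 * ennreal ((simple_value (l n) \<omega> z)\<^sup>2)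
        + 2 * ennreal ((simple_value (l n) \<omega> z - \<Phi> \<omega> z)\<^sup>2) \<partial>lborel \<partial>M)"
      by (intro nn_integral_mono ennreal_square_le)
    also have "\<dots> = (\<integral>\<^sup>+\<omega>. 2 * (\<integral>\<^sup>+z. ennreal ((simple_value (l n) \<omega> z)\<^sup>2) \<partial>lborel)
        + 2 * (\<integral>\<^sup>+z. ennreal ((simple_value (l n) \<omega> z - \<Phi> \<omega> z)\<^sup>2) \<partial>lborel) \<partial>M)"
      by (intro nn_integral_cong) (simp add: nn_integral_add nn_integral_cmult)
    also have "\<dots> = 2 * ?V + 2 * D n"
      unfolding D_def by (subst nn_integral_add; simp add: nn_integral_cmult)
    finally have F: "?F \<le> 2 * ?V + 2 * D n" .
    have "ennreal (G\<^sup>2) + ?V = (\<integral>\<^sup>+\<omega>. ennreal ((G + simple_integral W (l n) \<omega>)\<^sup>2) \<partial>M)"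
      by (rule simple_integral_second_moment[OF l assms(2), symmetric])
    also have "\<dots> \<le> (\<integral>\<^sup>+\<omega>. 2 * ennreal ((G + I \<omega>)\<^sup>2)
        + 2 * ennreal ((simple_integral W (l n) \<omega> - I \<omega>)\<^sup>2) \<partial>M)"
    proof (rule nn_integral_mono)
      fix \<omega>
      have "(G + I \<omega> - (G + simple_integral W (l n) \<omega>))\<^sup>2 = (simple_integral W (l n) \<omega> - I \<omega>)\<^sup>2"
        by (simp add: power2_commute)
      then show "ennreal ((G + simple_integral W (l n) \<omega>)\<^sup>2) \<le> 2 * ennreal ((G + I \<omega>)\<^sup>2)
          + 2 * ennreal ((simple_integral W (l n) \<omega> - I \<omega>)\<^sup>2)"
        using ennreal_square_le[of "G + simple_integral W (l n) \<omega>" "G + I \<omega>"] by simp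
    qed
    also have "\<dots> = 2 * ?K + 2 * E n"
      unfolding E_def by (subst nn_integral_add; simp add: nn_integral_cmult)
    finally have S: "ennreal (G\<^sup>2) + ?V \<le> 2 * ?K + 2 * E n" .
    \<comment> \<open>The coefficient of \<open>G\<^sup>2\<close> is raised to 2 so that the bound
      \<open>S\<close> can be doubled as a whole; the two doublings together produce the factor
      4.\<close>
    have "ennreal (G\<^sup>2) + ?F \<le> 2 * ennreal (G\<^sup>2) + (2 * ?V + 2 * D n)"
      using F by (intro add_mono) (auto simp: mult_2)
    also have "\<dots> = 2 * (ennreal (G\<^sup>2) + ?V) + 2 * D n" by (simp add: distrib_left add.assoc)
    also have "\<dots> \<le> 2 * (2 * ?K + 2 * E n) + 2 * D n"
      using S by (intro add_right_mono mult_left_mono) auto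
    also have "\<dots> = 4 * ?K + 4 * E n + 2 * D n" by (simp add: distrib_left mult.assoc[symmetric])
    finally show ?thesis .
  qed
  have "(\<lambda>n. 4 * ?K + 4 * E n + 2 * D n) \<longlonglongrightarrow> 4 * ?K + 4 * 0 + 2 * 0"
    unfolding D_def E_def using d e by (intro tendsto_add tendsto_const ennreal_tendsto_cmult) auto
  then have "ennreal (G\<^sup>2) + ?F \<le> 4 * ?K + 4 * 0 + 2 * 0"
    using le by (intro LIMSEQ_le_const) auto
  then show ?thesis by simp
qed

end

section \<open>The stable heat kernel\<close>

lemma stable_heat_kernel_measurable:
  "stable_heat_kernel \<alpha> p \<Longrightarrow> 0 < t \<Longrightarrow> p t \<in> borel_measurable borel"
  unfolding stable_heat_kernel_def by (auto intro: borel_measurable_continuous_onI)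

lemma stable_heat_kernel_nonneg: "stable_heat_kernel \<alpha> p \<Longrightarrow> 0 < t \<Longrightarrow> 0 \<le> p t x"
  by (simp add: stable_heat_kernel_def)

lemma stable_heat_kernel_distribution:
  assumes p: "stable_heat_kernel \<alpha> p" and t: "0 < t"
  shows "real_distribution (density lborel (\<lambda>x. ennreal (p t x)))" (is "real_distribution ?P")
proof -
  have "char ?P 0 = 1" using assms by (simp add: stable_heat_kernel_def)
  then have "measure ?P UNIV = 1" by (simp add: char_def scaleR_conv_of_real)
  \<comment> \<open>\<open>measure\<close> assigns 0 to infinite mass, so the value 1 rules out an
    infinite total mass.\<close>
  then have "emeasure ?P (space ?P) = 1"
    by (cases "emeasure ?P UNIV") (simp_all add: measure_def)
  then have "prob_space ?P" by (rule prob_spaceI)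
  then show ?thesis by (simp add: real_distribution_def real_distribution_axioms_def)
qed

text \<open>Dilation by \<open>t powr (1 / \<alpha>)\<close> turns the exponent at time 1 into the
  one at time \<open>t\<close>. Levy's theorem identifies laws, so the scaling is stated for
  measures; this suffices to carry interval probabilities from time 1 to time
  \<open>t\<close>.\<close>

lemma stable_heat_kernel_scaling:
  assumes p: "stable_heat_kernel \<alpha> p" and t: "0 < t" and "0 < \<alpha>"
  shows "density lborel (\<lambda>x. ennreal (p t x)) =
    distr (density lborel (\<lambda>x. ennreal (p 1 x))) borel (\<lambda>x. t powr (1 / \<alpha>) * x)" (is "?P = distr ?Q _ ?f")
proof (rule Levy_uniqueness)
  interpret Q: real_distribution ?Q by (rule stable_heat_kernel_distribution[OF p]) simp
  show "real_distribution ?P" by (rule stable_heat_kernel_distribution[OF p t])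
  have f: "?f \<in> borel_measurable ?Q" by simp
  show "real_distribution (distr ?Q borel ?f)"
    using Q.prob_space_distr[OF f] by (simp add: real_distribution_def real_distribution_axioms_def)
  show "char ?P = char (distr ?Q borel ?f)"
  proof
    fix \<xi>
    have "char (distr ?Q borel ?f) \<xi> = char ?Q (t powr (1 / \<alpha>) * \<xi>)"
      unfolding char_def by (subst integral_distr[OF f]) (auto simp: ac_simps)
    also have "\<dots> = complex_of_real (exp (- (\<bar>t powr (1 / \<alpha>) * \<xi>\<bar> powr \<alpha>)))"
      using p by (simp add: stable_heat_kernel_def)
    also have "\<bar>t powr (1 / \<alpha>) * \<xi>\<bar> powr \<alpha> = t * \<bar>\<xi>\<bar> powr \<alpha>"
      using assms by (simp add: abs_mult powr_mult powr_powr)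
    finally show "char ?P \<xi> = char (distr ?Q borel ?f) \<xi>"
      using p t by (simp add: stable_heat_kernel_def)
  qed
qed

text \<open>Half of the mass at time \<open>t\<close> lies in an interval of length \<open>2R\<close>, \<open>R = K t\<^bsup>1/\<alpha>\<^esup>\<close>; then
  \<open>p\<^sup>2 \<ge> 2bp - b\<^sup>2\<close> with \<open>b = 1/(4R)\<close> stands in for Cauchy-Schwarz.\<close>

lemma stable_heat_kernel_square_integral:
  assumes p: "stable_heat_kernel \<alpha> p" and "0 < \<alpha>"
  obtains c where "0 < c"
    "\<And>t. 0 < t \<Longrightarrow> ennreal (c * t powr (- 1 / \<alpha>)) \<le> (\<integral>\<^sup>+y. ennreal ((p t y)\<^sup>2) \<partial>lborel)"
proof -
  let ?P = "\<lambda>t. density lborel (\<lambda>x. ennreal (p t x))"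
  interpret Q: real_distribution "?P 1" by (rule stable_heat_kernel_distribution[OF p]) simp
  have "(\<lambda>n. measure (?P 1) {- real n..real n}) \<longlonglongrightarrow> measure (?P 1) (\<Union>n. {- real n..real n})"
    by (rule Q.finite_Lim_measure_incseq) (auto simp: incseq_def)
  moreover have "(\<Union>n. {- real n..real n}) = UNIV"
  proof -
    have "x \<in> (\<Union>n. {- real n..real n})" for x
      using real_arch_simple[of "\<bar>x\<bar>"] by (auto simp: abs_le_iff minus_le_iff)
    then show ?thesis by blast
  qed
  ultimately have "(\<lambda>n. measure (?P 1) {- real n..real n}) \<longlonglongrightarrow> 1"
    using Q.prob_space by simp
  \<comment> \<open>The radius is fixed from the law at time 1, so \<open>K\<close> does not depend
    on \<open>t\<close>. Demanding \<open>1 \<le> n\<close> keeps it positive.\<close>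
  then have "\<forall>\<^sub>F n in sequentially. 1 / 2 < measure (?P 1) {- real n..real n} \<and> 1 \<le> n"
    by (intro eventually_conj order_tendstoD eventually_ge_at_top) auto
  then obtain n where n: "1 / 2 < measure (?P 1) {- real n..real n}" "1 \<le> n"
    by (auto simp: eventually_sequentially)
  define K where "K = real n"
  have K: "0 < K" using n by (simp add: K_def)
  show ?thesis
  proof (rule that[of "1 / (8 * K)"])
    show "0 < 1 / (8 * K)" using K by simp
    fix t :: real assume t: "0 < t"
    define r where "r = t powr (1 / \<alpha>)"
    define R where "R = K * r"
    \<comment> \<open>Maximises the gain: half of the mass gives at least
      \<open>2 * b * (1 / 2) = b\<close>, and the interval costs
      \<open>b\<^sup>2 * (2 * R) = b / 2\<close>. What is left is
      \<open>b / 2 = 1 / (8 * R)\<close>, the origin of the constant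
      \<open>1 / (8 * K)\<close>.\<close>
    define b where "b = 1 / (4 * R)"
    have r: "0 < r" using t by (simp add: r_def)
    have R: "0 < R" using K r by (simp add: R_def)
    have b: "0 < b" using R by (simp add: b_def)
    note [measurable] = stable_heat_kernel_measurable[OF p t]
    have "(\<lambda>x. r * x) -` {- R..R} = {- K..K}"
      using r by (auto simp: R_def field_simps)
        (metis mult.commute mult_le_cancel_left_pos mult_minus_right)+
    then have "measure (?P t) {- R..R} = measure (?P 1) {- K..K}"
      unfolding stable_heat_kernel_scaling[OF p t \<open>0 < \<alpha>\<close>]
      by (subst measure_distr) (auto simp: r_def)
    then have "1 / 2 \<le> measure (?P t) {- R..R}" using n by (simp add: K_def)
    moreover interpret P: real_distribution "?P t" by (rule stable_heat_kernel_distribution[OF p t])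
    have "emeasure (?P t) {- R..R} = (\<integral>\<^sup>+y. ennreal (p t y) * indicator {- R..R} y \<partial>lborel)"
      by (subst emeasure_density) auto
    ultimately have half: "ennreal (1 / 2) \<le> (\<integral>\<^sup>+y. ennreal (p t y) * indicator {- R..R} y \<partial>lborel)"
      using P.emeasure_eq_measure by (metis ennreal_leI)
    let ?J = "\<integral>\<^sup>+y. ennreal ((p t y)\<^sup>2) \<partial>lborel"
    have "ennreal b \<le> ennreal (2 * b) * (\<integral>\<^sup>+y. ennreal (p t y) * indicator {- R..R} y \<partial>lborel)"
    proof -
      have "ennreal b = ennreal (2 * b) * ennreal (1 / 2)"
        using b by (subst ennreal_mult[symmetric]) auto
      also have "\<dots> \<le> ennreal (2 * b) * (\<integral>\<^sup>+y. ennreal (p t y) * indicator {- R..R} y \<partial>lborel)"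
        using half by (rule mult_left_mono) simp
      finally show ?thesis .
    qed
    also have "\<dots> = (\<integral>\<^sup>+y. ennreal (2 * b) * (ennreal (p t y) * indicator {- R..R} y) \<partial>lborel)"
      by (rule nn_integral_cmult[symmetric]) simp
    also have "\<dots> \<le> (\<integral>\<^sup>+y. ennreal ((p t y)\<^sup>2) + ennreal (b\<^sup>2) * indicator {- R..R} y \<partial>lborel)"
    proof (rule nn_integral_mono)
      fix y
      have "0 \<le> (p t y - b)\<^sup>2" by simp
      then have "2 * b * p t y \<le> (p t y)\<^sup>2 + b\<^sup>2" by (simp add: power2_diff ac_simps)
      then have "ennreal (2 * b * p t y) \<le> ennreal ((p t y)\<^sup>2 + b\<^sup>2)" by (rule ennreal_leI)
      then show "ennreal (2 * b) * (ennreal (p t y) * indicator {- R..R} y)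
          \<le> ennreal ((p t y)\<^sup>2) + ennreal (b\<^sup>2) * indicator {- R..R} y"
        using b stable_heat_kernel_nonneg[OF p t, of y]
        by (simp add: ennreal_mult ennreal_plus split: split_indicator)
    qed
    also have "\<dots> = ?J + ennreal (b\<^sup>2) * emeasure lborel {- R..R}"
      by (subst nn_integral_add) (auto simp: nn_integral_cmult)
    also have "\<dots> = ?J + ennreal (b / 2)"
      using R b by (simp add: ennreal_mult[symmetric]) (simp add: b_def power2_eq_square)
    finally have *: "ennreal b \<le> ?J + ennreal (b / 2)" .
    have "ennreal (b / 2) \<le> ?J"
    proof (cases ?J)
      case (real j)
      then have "ennreal b \<le> ennreal (j + b / 2)" using * b by (simp add: ennreal_plus)
      then have "b \<le> j + b / 2" using real b by (subst (asm) ennreal_le_iff) auto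
      then show ?thesis using real by (simp add: ennreal_leI)
    qed simp
    moreover have "b / 2 = 1 / (8 * K) * t powr (- 1 / \<alpha>)"
      using K r by (simp add: b_def R_def r_def powr_minus_divide)
    ultimately show "ennreal (1 / (8 * K) * t powr (- 1 / \<alpha>)) \<le> ?J" by simp
  qed
qed

lemma stable_heat_kernel_integral:
  assumes p: "stable_heat_kernel \<alpha> p" and t: "0 < t"
  shows "has_bochner_integral lborel (\<lambda>y. p t (x - y)) 1"
proof -
  note [measurable] = stable_heat_kernel_measurable[OF assms]
  interpret P: real_distribution "density lborel (\<lambda>x. ennreal (p t x))"
    by (rule stable_heat_kernel_distribution[OF assms])
  have "1 = (\<integral>\<^sup>+y. ennreal (p t y) \<partial>lborel)"
    using P.emeasure_space_1 by (simp add: emeasure_density)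
  also have "\<dots> = (\<integral>\<^sup>+y. ennreal (p t (x - y)) \<partial>lborel)"
    by (subst nn_integral_real_affine[where c = "-1" and t = x]) auto
  finally show ?thesis
    using stable_heat_kernel_nonneg[OF assms]
    by (intro has_bochner_integral_nn_integral) auto
qed

lemma heat_flow_lower_bound:
  assumes p: "stable_heat_kernel \<alpha> p" and t: "0 < t"
    and u0: "u0 \<in> borel_measurable borel" "bounded (range u0)" "\<And>x. \<kappa> \<le> u0 x"
  shows "\<kappa> \<le> heat_flow p u0 t x"
proof -
  note [measurable] = stable_heat_kernel_measurable[OF p t] u0(1)
  note P = stable_heat_kernel_integral[OF p t, of x]
  note nn = stable_heat_kernel_nonneg[OF p t]
  obtain C where C: "\<And>y. \<bar>u0 y\<bar> \<le> C" using u0(2) unfolding bounded_iff by auto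
  have int: "integrable lborel (\<lambda>y. p t (x - y))" using P by (simp add: has_bochner_integral_iff)
  have "has_bochner_integral lborel (\<lambda>y. p t (x - y) * \<kappa>) (1 * \<kappa>)"
    using P by (rule has_bochner_integral_mult_left)
  then have "\<kappa> = (\<integral>y. p t (x - y) * \<kappa> \<partial>lborel)" by (simp add: has_bochner_integral_iff)
  also have "\<dots> \<le> (\<integral>y. p t (x - y) * u0 y \<partial>lborel)"
  proof (rule integral_mono)
    show "integrable lborel (\<lambda>y. p t (x - y) * \<kappa>)" using int by simp
    \<comment> \<open>Without integrability the Bochner integral would default to 0 and the bound
      could fail; boundedness of \<open>u0\<close> supplies the dominating function.\<close>
    show "integrable lborel (\<lambda>y. p t (x - y) * u0 y)"
    proof (rule Bochner_Integration.integrable_bound)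
      show "integrable lborel (\<lambda>y. p t (x - y) * C)" using int by simp
      have "norm (p t (x - y) * u0 y) \<le> norm (p t (x - y) * C)" for y
      proof -
        have "\<bar>u0 y\<bar> \<le> \<bar>C\<bar>" using C[of y] by linarith
        then show ?thesis by (simp add: abs_mult mult_left_mono)
      qed
      then show "AE y in lborel. norm (p t (x - y) * u0 y) \<le> norm (p t (x - y) * C)" by simp
    qed simp
    show "p t (x - y) * \<kappa> \<le> p t (x - y) * u0 y" for y
      using nn u0(3) by (intro mult_left_mono) auto
  qed
  finally show ?thesis by (simp add: heat_flow_def)
qed

section \<open>Growth of the second moment\<close>

text \<open>Jensen's inequality in a form that allows infinite moments: integrate the tangent line of
  \<open>v \<mapsto> v\<^bsup>1+\<gamma>\<^esup>\<close> at \<open>A\<close>.\<close>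

lemma (in prob_space) moment_power_lower_bound:
  fixes Y :: "'a \<Rightarrow> real"
  assumes [measurable]: "Y \<in> borel_measurable M" and "0 < \<gamma>" "0 \<le> A"
    and A: "ennreal A \<le> (\<integral>\<^sup>+\<omega>. ennreal (\<bar>Y \<omega>\<bar>\<^sup>2) \<partial>M)"
  shows "ennreal (A powr (1 + \<gamma>)) \<le> (\<integral>\<^sup>+\<omega>. ennreal ((\<bar>Y \<omega>\<bar> powr (1 + \<gamma>))\<^sup>2) \<partial>M)"
    (is "_ \<le> ?J")
proof -
  have tangent: "(1 + \<gamma>) * A powr \<gamma> * v \<le> v powr (1 + \<gamma>) + \<gamma> * A powr (1 + \<gamma>)" if "0 \<le> v" for v
  proof -
    \<comment> \<open>Young's inequality with the conjugate exponents \<open>1 + \<gamma>\<close>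
      and \<open>(1 + \<gamma>) / \<gamma>\<close>, multiplied by \<open>1 + \<gamma>\<close>, is
      the tangent-line inequality; no derivative is taken, and \<open>v = 0\<close> and
      \<open>A = 0\<close> are included.\<close>
    have "v * A powr \<gamma> \<le> v powr (1 + \<gamma>) / (1 + \<gamma>) +
        (A powr \<gamma>) powr ((1 + \<gamma>) / \<gamma>) / ((1 + \<gamma>) / \<gamma>)"
      using \<open>0 < \<gamma>\<close> that by (intro Youngs_inequality) (auto simp: field_simps)
    also have "(A powr \<gamma>) powr ((1 + \<gamma>) / \<gamma>) = A powr (1 + \<gamma>)"
      using \<open>0 < \<gamma>\<close> by (simp add: powr_powr)
    finally have "(1 + \<gamma>) * (v * A powr \<gamma>) \<le>
        (1 + \<gamma>) * (v powr (1 + \<gamma>) / (1 + \<gamma>) + A powr (1 + \<gamma>) / ((1 + \<gamma>) / \<gamma>))"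
      using \<open>0 < \<gamma>\<close> by (intro mult_left_mono) auto
    also have "\<dots> = v powr (1 + \<gamma>) + \<gamma> * A powr (1 + \<gamma>)"
      using \<open>0 < \<gamma>\<close> by (simp add: distrib_left)
    finally show ?thesis by (simp add: ac_simps)
  qed
  have AA: "A powr \<gamma> * A = A powr (1 + \<gamma>)"
    using \<open>0 \<le> A\<close> by (simp add: powr_add mult.commute)
  have "ennreal ((1 + \<gamma>) * A powr (1 + \<gamma>)) = ennreal ((1 + \<gamma>) * A powr \<gamma>) * ennreal A"
    using \<open>0 < \<gamma>\<close> \<open>0 \<le> A\<close> by (simp add: ennreal_mult[symmetric] AA[symmetric] mult.assoc)
  also have "\<dots> \<le> ennreal ((1 + \<gamma>) * A powr \<gamma>) * (\<integral>\<^sup>+\<omega>. ennreal (\<bar>Y \<omega>\<bar>\<^sup>2) \<partial>M)"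
    using A by (intro mult_left_mono) auto
  also have "\<dots> = (\<integral>\<^sup>+\<omega>. ennreal ((1 + \<gamma>) * A powr \<gamma>) * ennreal (\<bar>Y \<omega>\<bar>\<^sup>2) \<partial>M)"
    by (rule nn_integral_cmult[symmetric]) simp
  also have "\<dots> \<le> (\<integral>\<^sup>+\<omega>. ennreal ((\<bar>Y \<omega>\<bar> powr (1 + \<gamma>))\<^sup>2) + ennreal (\<gamma> * A powr (1 + \<gamma>)) \<partial>M)"
  proof (rule nn_integral_mono)
    fix \<omega>
    have "(\<bar>Y \<omega>\<bar>\<^sup>2) powr (1 + \<gamma>) = (\<bar>Y \<omega>\<bar> powr (1 + \<gamma>))\<^sup>2"
      by (simp only: power2_eq_square powr_mult abs_ge_zero)
    then have "ennreal ((1 + \<gamma>) * A powr \<gamma> * \<bar>Y \<omega>\<bar>\<^sup>2) \<le>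
        ennreal ((\<bar>Y \<omega>\<bar> powr (1 + \<gamma>))\<^sup>2 + \<gamma> * A powr (1 + \<gamma>))"
      using tangent[of "\<bar>Y \<omega>\<bar>\<^sup>2"] by (intro ennreal_leI) auto
    then show "ennreal ((1 + \<gamma>) * A powr \<gamma>) * ennreal (\<bar>Y \<omega>\<bar>\<^sup>2) \<le>
        ennreal ((\<bar>Y \<omega>\<bar> powr (1 + \<gamma>))\<^sup>2) + ennreal (\<gamma> * A powr (1 + \<gamma>))"
      using \<open>0 < \<gamma>\<close> by (simp add: ennreal_mult[symmetric] ennreal_plus[symmetric] del: ennreal_plus)
  qed
  also have "\<dots> = ?J + ennreal (\<gamma> * A powr (1 + \<gamma>))"
    by (subst nn_integral_add) (auto simp: emeasure_space_1)
  finally have *: "ennreal ((1 + \<gamma>) * A powr (1 + \<gamma>)) \<le> ?J + ennreal (\<gamma> * A powr (1 + \<gamma>))" .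
  show ?thesis
  proof (cases ?J)
    case (real j)
    then have "ennreal ((1 + \<gamma>) * A powr (1 + \<gamma>)) \<le> ennreal (j + \<gamma> * A powr (1 + \<gamma>))"
      using * \<open>0 < \<gamma>\<close> by (simp add: ennreal_plus)
    then have "(1 + \<gamma>) * A powr (1 + \<gamma>) \<le> j + \<gamma> * A powr (1 + \<gamma>)"
      using real \<open>0 < \<gamma>\<close> by (subst (asm) ennreal_le_iff) auto
    then show ?thesis using real by (simp add: ennreal_leI distrib_right)
  qed simp
qed

text \<open>The mild equation may be used only where the moment is finite; elsewhere the right side
  is infinite. The summand \<open>\<kappa>\<^sup>2\<close> is kept so that the choice
  \<open>A = 0\<close> yields the starting bound of the iteration. The 4 is the loss from
  \<open>walsh_integral_lower_bound\<close>.\<close>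

lemma (in white_noise) second_moment_growth:
  assumes p: "stable_heat_kernel \<alpha> p" and "1 < \<alpha>"
    and c: "0 \<le> c" "\<And>r. 0 < r \<Longrightarrow>
      ennreal (c * r powr (- 1 / \<alpha>)) \<le> (\<integral>\<^sup>+y. ennreal ((p r y)\<^sup>2) \<partial>lborel)"
    and \<sigma>: "0 < \<gamma>" "\<And>x. \<bar>x\<bar> powr (1 + \<gamma>) \<le> \<sigma> x"
    and u: "mild_solution M W p \<sigma> u0 u"
    and \<kappa>: "0 \<le> \<kappa>" "\<And>t x. 0 < t \<Longrightarrow> \<kappa> \<le> heat_flow p u0 t x"
    and A: "0 \<le> T" "0 \<le> A" "\<And>s y. T < s \<Longrightarrow> ennreal A \<le> second_moment M u s y"
    and t: "T < t"
  shows "ennreal (\<kappa>\<^sup>2 + c * A powr (1 + \<gamma>) * (t - T) powr (1 - 1 / \<alpha>)) \<le> 4 * second_moment M u t x"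
proof (cases "second_moment M u t x < \<infinity>")
  case False
  then have "second_moment M u t x = \<infinity>" by (simp add: less_top[symmetric])
  then show ?thesis by (simp add: ennreal_mult_eq_top_iff)
next
  case True
  define \<Phi> where "\<Phi> = (\<lambda>\<omega> (s, y). indicator {0<..<t} s * (p (t - s) (x - y) * \<sigma> (u s y \<omega>)))"
  define G where "G = heat_flow p u0 t x"
  have G: "\<kappa> \<le> G" "0 \<le> G" using \<kappa> A(1) t by (auto simp: G_def intro: order_trans[OF \<kappa>(1)])
  obtain I where I: "has_walsh_integral M W \<Phi> I" and eq: "AE \<omega> in M. u t x \<omega> = G + I \<omega>"
  proof -
    have "0 < t" using A(1) t by simp
    then show ?thesis using u True that unfolding mild_solution_def \<Phi>_def G_def by blast
  qed
  have \<Phi>: "case_prod \<Phi> \<in> borel_measurable (M \<Otimes>\<^sub>M lborel)"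
    using I by (simp add: has_walsh_integral_def)
  have uM: "u s y \<in> borel_measurable M" if "0 < s" for s y
    using u that measurable_noise_algebra unfolding mild_solution_def noise_filtration_eq by blast
  define g where "g z = (\<integral>\<^sup>+\<omega>. ennreal ((\<Phi> \<omega> z)\<^sup>2) \<partial>M)" for z
  interpret MZ: pair_sigma_finite M "lborel :: (real \<times> real) measure" ..
  have [measurable]: "(\<lambda>(\<omega>, z). ennreal ((\<Phi> \<omega> z)\<^sup>2)) \<in> borel_measurable (M \<Otimes>\<^sub>M lborel)"
    using \<Phi> by (simp add: split_beta)
  have g: "g \<in> borel_measurable (lborel \<Otimes>\<^sub>M lborel)"
    unfolding g_def lborel_prod by measurable
  define B where "B = A powr (1 + \<gamma>)"
  \<comment> \<open>For \<open>T < s < t\<close> the factor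
    \<open>(t - s) powr (- 1 / \<alpha>)\<close> is at least its value at \<open>s = T\<close>.
    Using this constant rate avoids integrating the singular power, gives the same power of
    \<open>t - T\<close>, and loses only a constant factor.\<close>
  define m where "m = c * B * (t - T) powr (- 1 / \<alpha>)"
  have B: "0 \<le> B" by (simp add: B_def)
  \<comment> \<open>The kernel is known to be measurable in space at each fixed time, so the bound
    is made slice by slice. Joint measurability of \<open>\<Phi>\<close> is supplied by its Walsh
    integrability.\<close>
  have slice: "ennreal m * indicator {T<..<t} s \<le> (\<integral>\<^sup>+y. g (s, y) \<partial>lborel)" for s
  proof (cases "T < s \<and> s < t")
    case s: True
    have s0: "0 < s" "0 < t - s" using s A(1) by auto
    note [measurable] = stable_heat_kernel_measurable[OF p s0(2)]
    have "m \<le> c * (t - s) powr (- 1 / \<alpha>) * B"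
    proof -
      have "(t - T) powr (- 1 / \<alpha>) \<le> (t - s) powr (- 1 / \<alpha>)"
        using s \<open>1 < \<alpha>\<close> by (intro powr_mono2') auto
      then have "c * B * (t - T) powr (- 1 / \<alpha>) \<le> c * B * (t - s) powr (- 1 / \<alpha>)"
        using c(1) B by (intro mult_left_mono) auto
      then show ?thesis by (simp add: m_def ac_simps)
    qed
    then have "ennreal m \<le> ennreal (c * (t - s) powr (- 1 / \<alpha>) * B)" by (rule ennreal_leI)
    also have "\<dots> = ennreal (c * (t - s) powr (- 1 / \<alpha>)) * ennreal B"
      using c(1) B by (intro ennreal_mult) auto
    also have "\<dots> \<le> (\<integral>\<^sup>+y. ennreal ((p (t - s) y)\<^sup>2) \<partial>lborel) * ennreal B"
      using c(2)[OF s0(2)] by (rule mult_right_mono) simp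
    also have "(\<integral>\<^sup>+y. ennreal ((p (t - s) y)\<^sup>2) \<partial>lborel) = (\<integral>\<^sup>+y. ennreal ((p (t - s) (x - y))\<^sup>2) \<partial>lborel)"
      by (subst nn_integral_real_affine[where c = "-1" and t = x]) auto
    also have "\<dots> * ennreal B = (\<integral>\<^sup>+y. ennreal ((p (t - s) (x - y))\<^sup>2) * ennreal B \<partial>lborel)"
      by (rule nn_integral_multc[symmetric]) simp
    also have "\<dots> \<le> (\<integral>\<^sup>+y. g (s, y) \<partial>lborel)"
    proof (rule nn_integral_mono)
      fix y
      note [measurable] = uM[OF s0(1), of y]
      have "ennreal B \<le> (\<integral>\<^sup>+\<omega>. ennreal ((\<bar>u s y \<omega>\<bar> powr (1 + \<gamma>))\<^sup>2) \<partial>M)"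
        unfolding B_def using A(3)[of s y] s
        by (intro moment_power_lower_bound uM s0 \<sigma>(1) A(2)) (simp add: second_moment_def)
      then have "ennreal ((p (t - s) (x - y))\<^sup>2) * ennreal B \<le>
          ennreal ((p (t - s) (x - y))\<^sup>2) * (\<integral>\<^sup>+\<omega>. ennreal ((\<bar>u s y \<omega>\<bar> powr (1 + \<gamma>))\<^sup>2) \<partial>M)"
        by (rule mult_left_mono) simp
      also have "\<dots> = (\<integral>\<^sup>+\<omega>. ennreal ((p (t - s) (x - y))\<^sup>2)
          * ennreal ((\<bar>u s y \<omega>\<bar> powr (1 + \<gamma>))\<^sup>2) \<partial>M)"
        by (rule nn_integral_cmult[symmetric]) simp
      also have "\<dots> \<le> g (s, y)"
        unfolding g_def
      proof (rule nn_integral_mono)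
        fix \<omega>
        have "(\<bar>u s y \<omega>\<bar> powr (1 + \<gamma>))\<^sup>2 \<le> (\<sigma> (u s y \<omega>))\<^sup>2"
          using \<sigma>(2) by (intro power_mono) auto
        then have "(p (t - s) (x - y))\<^sup>2 * (\<bar>u s y \<omega>\<bar> powr (1 + \<gamma>))\<^sup>2 \<le> (\<Phi> \<omega> (s, y))\<^sup>2"
          using s s0 by (simp add: \<Phi>_def power_mult_distrib mult_left_mono)
        then show "ennreal ((p (t - s) (x - y))\<^sup>2) * ennreal ((\<bar>u s y \<omega>\<bar> powr (1 + \<gamma>))\<^sup>2)
            \<le> ennreal ((\<Phi> \<omega> (s, y))\<^sup>2)"
          by (subst ennreal_mult[symmetric]) (auto intro: ennreal_leI)
      qed
      finally show "ennreal ((p (t - s) (x - y))\<^sup>2) * ennreal B \<le> g (s, y)" .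
    qed
    finally show ?thesis using s by simp
  qed auto
  have mt: "m * (t - T) = c * B * (t - T) powr (1 - 1 / \<alpha>)"
  proof -
    have "(t - T) powr (1 - 1 / \<alpha>) = (t - T) powr (- 1 / \<alpha> + 1)" by (simp add: algebra_simps)
    also have "\<dots> = (t - T) powr (- 1 / \<alpha>) * (t - T)" using t by (subst powr_add) auto
    finally show ?thesis by (simp add: m_def)
  qed
  have m: "0 \<le> m" using c(1) B by (simp add: m_def)
  have "ennreal (m * (t - T)) = ennreal m * emeasure lborel {T<..<t}"
    using t m by (simp add: ennreal_mult)
  also have "\<dots> = (\<integral>\<^sup>+s. ennreal m * indicator {T<..<t} s \<partial>lborel)"
    by (rule nn_integral_cmult_indicator[symmetric]) simp
  also have "\<dots> \<le> (\<integral>\<^sup>+s. \<integral>\<^sup>+y. g (s, y) \<partial>lborel \<partial>lborel)"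
    by (intro nn_integral_mono slice)
  also have "\<dots> = (\<integral>\<^sup>+z. g z \<partial>lborel)"
    using lborel.nn_integral_fst[OF g] by (simp add: lborel_prod)
  also have "\<dots> = (\<integral>\<^sup>+\<omega>. \<integral>\<^sup>+z. ennreal ((\<Phi> \<omega> z)\<^sup>2) \<partial>lborel \<partial>M)"
    unfolding g_def by (rule MZ.Fubini') measurable
  finally have noise: "ennreal (m * (t - T)) \<le> \<dots>" .
  have "ennreal (\<kappa>\<^sup>2 + m * (t - T)) = ennreal (\<kappa>\<^sup>2) + ennreal (m * (t - T))"
    using m t by (intro ennreal_plus) auto
  also have "\<dots> \<le> ennreal (G\<^sup>2) + (\<integral>\<^sup>+\<omega>. \<integral>\<^sup>+z. ennreal ((\<Phi> \<omega> z)\<^sup>2) \<partial>lborel \<partial>M)"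
    using \<kappa>(1) G by (intro add_mono ennreal_leI power_mono noise)
  also have "\<dots> \<le> 4 * (\<integral>\<^sup>+\<omega>. ennreal ((G + I \<omega>)\<^sup>2) \<partial>M)"
    by (rule walsh_integral_lower_bound[OF I G(2)])
  also have "(\<integral>\<^sup>+\<omega>. ennreal ((G + I \<omega>)\<^sup>2) \<partial>M) = second_moment M u t x"
    unfolding second_moment_def
    by (rule nn_integral_cong_AE) (use eq in eventually_elim, simp)
  finally show ?thesis unfolding mt B_def .
qed

text \<open>Only a bound valid at all later times and all points can be fed back into
  \<open>step\<close>. The induction therefore carries this uniformity in \<open>x\<close>, and the
  blow-up time depends on the constants alone.\<close>

lemma power_growth_blow_up:
  fixes F :: "real \<Rightarrow> 'b \<Rightarrow> ennreal"
  assumes "0 < c" "0 < \<beta>" "0 < \<gamma>" "0 < a"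
    and base: "\<And>t x. 0 < t \<Longrightarrow> ennreal a \<le> F t x"
    and step: "\<And>T A t x. 0 \<le> T \<Longrightarrow> 0 < A \<Longrightarrow> (\<And>s y. T < s \<Longrightarrow> ennreal A \<le> F s y) \<Longrightarrow> T < t \<Longrightarrow>
      ennreal (c * A powr (1 + \<gamma>) * (t - T) powr \<beta>) \<le> F t x"
  shows "\<exists>t0>0. \<forall>x. \<forall>t\<ge>t0. F t x = \<infinity>"
proof -
  \<comment> \<open>Doubling a bound \<open>A\<close> takes a time \<open>r\<close> with
    \<open>c * A powr \<gamma> * r powr \<beta> = 2\<close>. For \<open>A = a\<close> this is
    \<open>D\<close>, and each doubling of \<open>A\<close> multiplies it by \<open>q\<close>, which
    is below 1 because \<open>\<gamma>\<close> is positive.\<close>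
  define D where "D = (2 / (c * a powr \<gamma>)) powr (1 / \<beta>)"
  define q where "q = 2 powr (- \<gamma> / \<beta>)"
  define T where "T n = D * (\<Sum>k<n. q ^ k)" for n
  have D: "0 < D" using assms by (simp add: D_def)
  have q: "0 < q" "q < 1" using assms by (simp_all add: q_def powr_less_one)
  have T0: "0 \<le> T n" for n using D q by (simp add: T_def sum_nonneg)
  \<comment> \<open>The inequality is strict, so the limiting time \<open>D / (1 - q)\<close>
    already lies after every \<open>T n\<close> and can itself serve as \<open>t0\<close>.\<close>
  have T_bound: "T n < D / (1 - q)" for n
  proof -
    have "(\<Sum>k<n. q ^ k) = (1 - q ^ n) / (1 - q)" using q by (simp add: sum_gp_strict)
    also have "\<dots> < 1 / (1 - q)" using q by (intro divide_strict_right_mono) auto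
    finally show ?thesis using D by (simp add: T_def divide_inverse)
  qed
  have wait: "c * (a * 2 ^ n) powr \<gamma> * (D * q ^ n) powr \<beta> = 2" for n
  proof -
    have "D powr \<beta> = 2 / (c * a powr \<gamma>)"
      using assms by (simp add: D_def powr_powr)
    moreover have "(q ^ n) powr \<beta> = 2 powr (- \<gamma> * real n)"
      using q(1) \<open>0 < \<beta>\<close> by (simp add: powr_realpow[symmetric] q_def powr_powr)
    moreover have "(2 ^ n :: real) powr \<gamma> = 2 powr (\<gamma> * real n)"
      by (simp add: powr_realpow[symmetric] powr_powr mult.commute)
    moreover have "2 powr (\<gamma> * real n) * 2 powr (- \<gamma> * real n) = (1 :: real)"
      by (simp add: powr_add[symmetric])
    ultimately show ?thesis
      using assms D q by (simp add: powr_mult field_simps)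
  qed
  have F: "ennreal (a * 2 ^ n) \<le> F t x" if "T n < t" for n t x
    using that
  proof (induction n arbitrary: t x)
    case 0
    then show ?case using base[of t x] by (simp add: T_def)
  next
    case (Suc n)
    have "T (Suc n) = T n + D * q ^ n" by (simp add: T_def distrib_left)
    then have t: "D * q ^ n < t - T n" using Suc.prems by simp
    have dq: "0 < D * q ^ n" using D q by simp
    have A: "0 < a * 2 ^ n" using assms by simp
    have "a * 2 ^ Suc n = a * 2 ^ n * (c * (a * 2 ^ n) powr \<gamma> * (D * q ^ n) powr \<beta>)"
      unfolding wait by simp
    also have "\<dots> = c * (a * 2 ^ n) powr (1 + \<gamma>) * (D * q ^ n) powr \<beta>"
      using A by (simp only: powr_add powr_one order_less_imp_le ac_simps)
    also have "\<dots> \<le> c * (a * 2 ^ n) powr (1 + \<gamma>) * (t - T n) powr \<beta>"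
      using t dq assms by (intro mult_left_mono powr_mono2) auto
    finally have "ennreal (a * 2 ^ Suc n) \<le> ennreal (c * (a * 2 ^ n) powr (1 + \<gamma>) * (t - T n) powr \<beta>)"
      by (rule ennreal_leI)
    also have "\<dots> \<le> F t x"
      using t dq by (intro step[OF T0 A Suc.IH]) auto
    finally show ?case .
  qed
  have "F t x = \<infinity>" if "D / (1 - q) \<le> t" for t x
  proof (rule ccontr)
    assume "F t x \<noteq> \<infinity>"
    then obtain r where r: "F t x = ennreal r" "0 \<le> r" by (cases "F t x") auto
    obtain n where n: "r / a < 2 ^ n" using real_arch_pow[of 2 "r / a"] by auto
    have "ennreal (a * 2 ^ n) \<le> ennreal r"
      using F[of n t x] T_bound[of n] that r(1) by simp
    then have "a * 2 ^ n \<le> r" using r(2) by (simp add: ennreal_le_iff)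
    then show False using n \<open>0 < a\<close> by (simp add: field_simps)
  qed
  moreover have "0 < D / (1 - q)" using D q by simp
  ultimately show ?thesis by blast
qed

theorem theorem1p2:
  fixes M :: "'a measure"
    and W :: "(real \<times> real) set \<Rightarrow> 'a \<Rightarrow> real"
    and p :: "real \<Rightarrow> real \<Rightarrow> real"
    and \<alpha> \<gamma> :: real
    and \<sigma> u0 :: "real \<Rightarrow> real"
    and u :: "real \<Rightarrow> real \<Rightarrow> 'a \<Rightarrow> real"
  assumes "1 < \<alpha>" and "\<alpha> < 2"
    and "stable_heat_kernel \<alpha> p"
    and "white_noise M W"
    and "local_lipschitz (UNIV :: real set) UNIV (\<lambda>_. \<sigma>)"
    and "\<gamma> > 0" and "\<And>x. \<sigma> x \<ge> \<bar>x\<bar> powr (1 + \<gamma>)"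
    and "u0 \<in> borel_measurable borel" and "\<And>x. 0 \<le> u0 x" and "bounded (range u0)"
    and "mild_solution M W p \<sigma> u0 u"
    and "(INF x. u0 x) > 0"
  shows "\<exists>t0>0. \<forall>x. \<forall>t\<ge>t0. second_moment M u t x = \<infinity>"
proof -
  interpret white_noise M W by fact
  define \<kappa> where "\<kappa> = (INF x. u0 x)"
  have \<kappa>: "0 < \<kappa>" using assms by (simp add: \<kappa>_def)
  \<comment> \<open>A real \<open>INF\<close> is a lower bound only when the range is bounded below,
    which nonnegativity of \<open>u0\<close> provides.\<close>
  have u0: "\<kappa> \<le> u0 x" for x
    unfolding \<kappa>_def using assms(9) by (intro cINF_lower bdd_belowI[of _ 0]) auto
  have flow: "\<kappa> \<le> heat_flow p u0 t x" if "0 < t" for t x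
    using assms that u0 by (intro heat_flow_lower_bound) auto
  obtain c where c: "0 < c" "\<And>r. 0 < r \<Longrightarrow>
      ennreal (c * r powr (- 1 / \<alpha>)) \<le> (\<integral>\<^sup>+y. ennreal ((p r y)\<^sup>2) \<partial>lborel)"
    using stable_heat_kernel_square_integral[OF assms(3)] assms(1) by auto
  note growth = second_moment_growth[OF assms(3,1) less_imp_le[OF c(1)] c(2) assms(6,7,11)
      less_imp_le[OF \<kappa>] flow]
  have quarter: "ennreal (r / 4) \<le> F" if "ennreal r \<le> 4 * F" "0 \<le> r" for r F
  proof (cases F)
    case (real f)
    then have "ennreal r \<le> ennreal (4 * f)" using that by (simp add: ennreal_mult)
    then have "r \<le> 4 * f" using real by (subst (asm) ennreal_le_iff) auto
    then show ?thesis using real by (simp add: ennreal_leI)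
  qed simp
  show ?thesis
  proof (rule power_growth_blow_up)
    show "0 < c / 4" "0 < 1 - 1 / \<alpha>" "0 < \<gamma>" "0 < \<kappa>\<^sup>2 / 4" using c \<kappa> assms by auto
    \<comment> \<open>With \<open>T = 0\<close> and \<open>A = 0\<close> the noise contribution
      vanishes, since \<open>0 powr (1 + \<gamma>) = 0\<close>, and only the initial datum
      remains.\<close>
    show "ennreal (\<kappa>\<^sup>2 / 4) \<le> second_moment M u t x" if "0 < t" for t x
      using growth[of 0 0 t x] that by (intro quarter) auto
    fix T A t x
    assume *: "0 \<le> T" "0 < A" "\<And>s y. T < s \<Longrightarrow> ennreal A \<le> second_moment M u s y" "T < t"
    let ?m = "c * A powr (1 + \<gamma>) * (t - T) powr (1 - 1 / \<alpha>)"
    have "ennreal ?m \<le> ennreal (\<kappa>\<^sup>2 + ?m)" by (rule ennreal_leI) simp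
    also have "\<dots> \<le> 4 * second_moment M u t x" using * by (intro growth) auto
    finally have "ennreal (?m / 4) \<le> second_moment M u t x" using c by (intro quarter) auto
    then show "ennreal (c / 4 * A powr (1 + \<gamma>) * (t - T) powr (1 - 1 / \<alpha>)) \<le> second_moment M u t x"
      by simp
  qed
qed

end
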